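(* Under the thermodynamic assumptions and the Lax condition stated in the context, there exist a function $\Lambda_0\in C^1(\mathcal{S}^N_+,\mathbb{R}^*_+)$ and, setting $$\mathcal{K}=\{\mathbf{s}\in S^+(\mathbf{s}_L):\ \mathbf{s}=\mathbf{s}_L+\lambda\mathbf{a},\ \mathbf{a}\in\mathcal{S}^N_+,\ \lambda\in(0,\Lambda_0(\mathbf{a}))\},$$ a unique map $\mathcal{T}\in C^0(\bar{\mathcal{K}},\mathbb{R}^*_+)\cap C^1(\mathcal{K},\mathbb{R}^*_+)$ with the following properties: (i) $\mathcal{H}(\mathcal{T}(\mathbf{s}),\mathbf{s})=0$ for all $\mathbf{s}\in\bar{\mathcal{K}}$; (ii) $\mathcal{F}(\mathcal{T}(\mathbf{s}),\mathbf{s})=0$ for all $\mathbf{s}\in\mathcal{C}$, where $\mathcal{C}=\{\mathbf{s}\in S^+(\mathbf{s}_L):\ \mathbf{s}=\mathbf{s}_L+\Lambda_0(\mathbf{a})\mathbf{a},\ \mathbf{a}\in\mathcal{S}^N_+\}$. In addition, $\mathcal{T}$ obeys (iii) $\mathcal{F}(\mathcal{T}(\mathbf{s}_L),\mathbf{s}_L)=0$; (iv) $\mathcal{F}(\mathcal{T}(\mathbf{s}),\mathbf{s})<0$ for all $\mathbf{s}\in\mathcal{K}$.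
   Context: For each $i=1,\dots,N$ the internal energy $e_i(\tau,s_i)$ is a smooth, strictly convex function of $\tau>0$ and $s_i\in\mathbb{R}$, with $p_i=-\partial e_i/\partial\tau>0$ and $T_i=\partial e_i/\partial s_i>0$. Write $\mathbf{s}=(s_1,\dots,s_N)$, $e(\tau,\mathbf{s})=\sum_ie_i(\tau,s_i)$, $p(\tau,\mathbf{s})=\sum_ip_i(\tau,s_i)$. Thermodynamic assumptions: for each $i$, $e_i\to+\infty$ as $\tau\to0^+$, $e_i\to+\infty$ as $s_i\to+\infty$, $e_i\to0$ as $\tau\to+\infty$, $\partial p_i/\partial s_i>0$, $\partial p_i/\partial\tau\to-\infty$ as $s_i\to+\infty$; for all $(\tau,\mathbf{s})$, $\partial^2p/\partial\tau^2>0$; for each $\mathbf{s}$, $p\to+\infty$ and $\partial p/\partial\tau\to-\infty$ as $\tau\to0^+$, and $p\to0$ and $\partial p/\partial\tau\to0$ as $\tau\to+\infty$. A state $\omega_L=(\tau_L,\mathbf{s}_L)$ with $\tau_L>0$ and a number $m>0$ are fixed, subject to the Lax condition $m^2+\partial_\tau p(\tau_L,\mathbf{s}_L)>0$, and $$\mathcal{F}(\tau,\mathbf{s})=p(\tau,\mathbf{s})-p(\tau_L,\mathbf{s}_L)+m^2(\tau-\tau_L),$$ $$\mathcal{H}(\tau,\mathbf{s})=e(\tau,\mathbf{s})-e(\tau_L,\mathbf{s}_L)-\frac{m^2}{2}(\tau^2-\tau_L^2)+(m^2\tau_L+p(\tau_L,\mathbf{s}_L))(\tau-\tau_L).$$ $\mathbb{R}_+=[0,\infty)$,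 $\mathbb{R}^*_+=(0,\infty)$, $\mathcal{S}^N_+=\{\mathbf{a}\in\mathbb{R}^N_+:\|\mathbf{a}\|=1\}$ (Euclidean norm), $S^+(\mathbf{s}_L)=\{\mathbf{s}_L+\lambda\mathbf{a}:\mathbf{a}\in\mathcal{S}^N_+,\lambda\ge0\}$. Bars denote closures.
   Formalization: Uniqueness of T is proved among maps satisfying (i), (ii) and (iii); with (i) and (ii) alone it fails, since the smaller root of H(·,s)=0, where F>0 on K, is also continuous on the closure, C¹ on K and satisfies (i) and (ii). *)

theory Defs
  imports "HOL-Analysis.Analysis"
begin

text \<open>\<open>Ck_on k U f\<close>: \<open>f\<close> is of class \<open>C\<^sup>k\<close> on the set \<open>U\<close>. The derivatives are full (not
  one-sided) ones, so this is meant for open \<open>U\<close>.\<close>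

primrec Ck_on :: "nat \<Rightarrow> 'a::real_normed_vector set \<Rightarrow> ('a \<Rightarrow> 'b::real_normed_vector) \<Rightarrow> bool" where
  "Ck_on 0 U f \<longleftrightarrow> continuous_on U f"
| "Ck_on (Suc k) U f \<longleftrightarrow> (\<forall>x\<in>U. f differentiable (at x)) \<and>
     (\<forall>v. Ck_on k U (\<lambda>x. frechet_derivative f (at x) v))"

definition smooth_on :: "'a::real_normed_vector set \<Rightarrow> ('a \<Rightarrow> 'b::real_normed_vector) \<Rightarrow> bool" where
  "smooth_on U f \<longleftrightarrow> (\<forall>k. Ck_on k U f)"

text \<open>\<open>C\<^sup>1\<close> on a set that need not be open, in the usual sense for subsets of Euclidean space:
  locally the restriction of a \<open>C\<^sup>1\<close> function on an open set. It is used below for the part of the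
  sphere in the closed orthant, and for the region \<open>\<K>\<close>, which contains part of its boundary.\<close>

definition C1_on :: "'a::real_normed_vector set \<Rightarrow> ('a \<Rightarrow> 'b::real_normed_vector) \<Rightarrow> bool" where
  "C1_on A f \<longleftrightarrow> (\<forall>x\<in>A. \<exists>U g. open U \<and> x \<in> U \<and> Ck_on 1 U g \<and> (\<forall>y\<in>A \<inter> U. g y = f y))"

definition strictly_convex_on :: "'a::real_vector set \<Rightarrow> ('a \<Rightarrow> real) \<Rightarrow> bool" where
  "strictly_convex_on S f \<longleftrightarrow> convex S \<and>
     (\<forall>x\<in>S. \<forall>y\<in>S. \<forall>u. x \<noteq> y \<longrightarrow> 0 < u \<longrightarrow> u < 1 \<longrightarrow>
        f ((1 - u) *\<^sub>R x + u *\<^sub>R y) < (1 - u) * f x + u * f y)"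

text \<open>A family of energies is a function \<open>e\<close> with \<open>e i \<tau> \<sigma>\<close> the \<open>i\<close>-th internal energy at specific
  volume \<open>\<tau>\<close> and entropy \<open>\<sigma>\<close>; only its values for \<open>\<tau> > 0\<close> matter.\<close>

definition pressure_i :: "('n \<Rightarrow> real \<Rightarrow> real \<Rightarrow> real) \<Rightarrow> 'n \<Rightarrow> real \<Rightarrow> real \<Rightarrow> real" where
  "pressure_i e i \<tau> \<sigma> = - deriv (\<lambda>t. e i t \<sigma>) \<tau>"

definition temperature_i :: "('n \<Rightarrow> real \<Rightarrow> real \<Rightarrow> real) \<Rightarrow> 'n \<Rightarrow> real \<Rightarrow> real \<Rightarrow> real" where
  "temperature_i e i \<tau> \<sigma> = deriv (\<lambda>s. e i \<tau> s) \<sigma>"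

definition energy :: "('n::finite \<Rightarrow> real \<Rightarrow> real \<Rightarrow> real) \<Rightarrow> real \<Rightarrow> real ^ 'n \<Rightarrow> real" where
  "energy e \<tau> s = (\<Sum>i\<in>UNIV. e i \<tau> (s $ i))"

definition pressure :: "('n::finite \<Rightarrow> real \<Rightarrow> real \<Rightarrow> real) \<Rightarrow> real \<Rightarrow> real ^ 'n \<Rightarrow> real" where
  "pressure e \<tau> s = (\<Sum>i\<in>UNIV. pressure_i e i \<tau> (s $ i))"

definition F_fun :: "('n::finite \<Rightarrow> real \<Rightarrow> real \<Rightarrow> real) \<Rightarrow> real \<Rightarrow> real ^ 'n \<Rightarrow> real \<Rightarrow>
    real \<Rightarrow> real ^ 'n \<Rightarrow> real" where
  "F_fun e \<tau>\<^sub>L s\<^sub>L m \<tau> s = pressure e \<tau> s - pressure e \<tau>\<^sub>L s\<^sub>L + m\<^sup>2 * (\<tau> - \<tau>\<^sub>L)"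

definition H_fun :: "('n::finite \<Rightarrow> real \<Rightarrow> real \<Rightarrow> real) \<Rightarrow> real \<Rightarrow> real ^ 'n \<Rightarrow> real \<Rightarrow>
    real \<Rightarrow> real ^ 'n \<Rightarrow> real" where
  "H_fun e \<tau>\<^sub>L s\<^sub>L m \<tau> s = energy e \<tau> s - energy e \<tau>\<^sub>L s\<^sub>L - m\<^sup>2 / 2 * (\<tau>\<^sup>2 - \<tau>\<^sub>L\<^sup>2)
     + (m\<^sup>2 * \<tau>\<^sub>L + pressure e \<tau>\<^sub>L s\<^sub>L) * (\<tau> - \<tau>\<^sub>L)"

definition pos_sphere :: "(real ^ 'n) set" where
  "pos_sphere = {a. (\<forall>i. 0 \<le> a $ i) \<and> norm a = 1}"

definition S_plus :: "real ^ 'n \<Rightarrow> (real ^ 'n) set" where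
  "S_plus s\<^sub>L = {s\<^sub>L + r *\<^sub>R a | r a. a \<in> pos_sphere \<and> 0 \<le> r}"

definition K_set :: "real ^ 'n \<Rightarrow> (real ^ 'n \<Rightarrow> real) \<Rightarrow> (real ^ 'n) set" where
  "K_set s\<^sub>L \<Lambda>\<^sub>0 =
     {s \<in> S_plus s\<^sub>L. \<exists>a r. s = s\<^sub>L + r *\<^sub>R a \<and> a \<in> pos_sphere \<and> 0 < r \<and> r < \<Lambda>\<^sub>0 a}"

definition C_set :: "real ^ 'n \<Rightarrow> (real ^ 'n \<Rightarrow> real) \<Rightarrow> (real ^ 'n) set" where
  "C_set s\<^sub>L \<Lambda>\<^sub>0 = {s \<in> S_plus s\<^sub>L. \<exists>a. s = s\<^sub>L + \<Lambda>\<^sub>0 a *\<^sub>R a \<and> a \<in> pos_sphere}"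

text \<open>\<open>T \<in> C\<^sup>0(closure K, ]0,\<infinity>[) \<inter> C\<^sup>1(K, ]0,\<infinity>[)\<close>; only the values on \<open>closure K\<close> matter.\<close>

definition C0_C1_pos :: "(real ^ 'n) set \<Rightarrow> (real ^ 'n \<Rightarrow> real) \<Rightarrow> bool" where
  "C0_C1_pos K T \<longleftrightarrow> continuous_on (closure K) T \<and> C1_on K T \<and> (\<forall>s\<in>closure K. 0 < T s)"

end

theory Submission
  imports Defs
begin

text \<open>
  Since \<open>H_\<tau> = - F\<close> and \<open>F\<close> is strictly convex in \<open>\<tau>\<close>, \<open>H\<close> increases strictly in \<open>\<tau>\<close> exactly on the
  interval \<open>{F \<le> 0}\<close>, so there is at most one \<open>\<tau>\<close> with \<open>F \<le> 0\<close> and \<open>H = 0\<close>; the map \<open>T\<close> is this root.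
  Along a ray from \<open>s\<^sub>L\<close> both \<open>F\<close> and \<open>H\<close> increase strictly. Hence \<open>{F \<le> 0}\<close> shrinks, starting inside
  \<open>(0, \<tau>\<^sub>L]\<close>, and the root persists until it reaches the left end of this interval: \<open>\<Lambda>\<^sub>0(a)\<close> is the
  largest \<open>r\<close> for which \<open>F \<le> 0\<close> and \<open>H \<le> 0\<close> hold at some \<open>(\<tau>, s\<^sub>L + r a)\<close>, and there
  \<open>F = H = 0\<close> and \<open>F_\<tau> < 0\<close>. It is finite because \<open>H > 0\<close> on \<open>(0, \<tau>\<^sub>L]\<close> far out on the ray. Regularity
  comes from the implicit function theorem: solve \<open>F = 0\<close> for \<open>\<tau>\<close>, then \<open>H = 0\<close> for \<open>r\<close>.
\<close>

section \<open>Implicit functions and maps of class C1\<close>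

text \<open>The injections of the factors as bounded operators: derivatives on products are composed
  inside the operator space, so continuity of an operator-valued derivative is obtained
  compositionally.\<close>

lift_definition blinfun_inl :: "'a::real_normed_vector \<Rightarrow>\<^sub>L ('a \<times> 'b::real_normed_vector)" is "\<lambda>h. (h, 0)"
  by (intro bounded_linear_Pair bounded_linear_ident bounded_linear_zero)

lift_definition blinfun_inr :: "'b::real_normed_vector \<Rightarrow>\<^sub>L ('a::real_normed_vector \<times> 'b)" is "\<lambda>k. (0, k)"
  by (intro bounded_linear_Pair bounded_linear_ident bounded_linear_zero)

declare blinfun_inl.rep_eq [simp] blinfun_inr.rep_eq [simp]

text \<open>The inverse function theorem applies to \<open>(x, y)\<close> \<mapsto>
  \<open>(x, G (x, y))\<close>, whose derivative is triangular and invertible where the last partial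
  derivative of \<open>G\<close> is nonzero. The second component of the local inverse at
  \<open>(x, 0)\<close> is \<open>g\<close>. Continuity of \<open>g'\<close> in operator norm is
  part of the conclusion so that \<open>g\<close> can be recognised as C1.\<close>

lemma implicit_function_real:
  fixes G :: "'a::euclidean_space \<times> real \<Rightarrow> real"
    and G' :: "'a \<times> real \<Rightarrow> ('a \<times> real) \<Rightarrow>\<^sub>L real"
  assumes "open S" and G': "\<And>z. z \<in> S \<Longrightarrow> (G has_derivative blinfun_apply (G' z)) (at z)"
    and cont: "continuous_on S G'"
    and z0: "(x0, y0) \<in> S" "G (x0, y0) = 0" "G' (x0, y0) (0, 1) \<noteq> 0"
  obtains U g g' where "open U" "x0 \<in> U" "g x0 = y0"
    "\<And>x. x \<in> U \<Longrightarrow> (g has_derivative blinfun_apply (g' x)) (at x)" "continuous_on U g'"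
    "\<And>x. x \<in> U \<Longrightarrow> (x, g x) \<in> S" "\<And>x. x \<in> U \<Longrightarrow> G (x, g x) = 0"
proof -
  have cont1: "continuous_on S (\<lambda>z. G' z (0, 1))"
    by (intro continuous_intros cont)
  \<comment> \<open>On the open set \<open>S'\<close> the last partial derivative never vanishes, so
    the quotient defining \<open>g'\<close> below makes sense on all of \<open>U\<close>.\<close>
  define S' where "S' = S \<inter> (\<lambda>z. G' z (0, 1)) -` (- {0})"
  have S': "open S'" "(x0, y0) \<in> S'" "S' \<subseteq> S" "\<And>z. z \<in> S' \<Longrightarrow> G' z (0, 1) \<noteq> 0"
    unfolding S'_def using continuous_open_preimage[OF cont1 \<open>open S\<close>] z0 by auto
  define f where "f = (\<lambda>z. (fst z, G z))"
  define f' where "f' = (\<lambda>z. (blinfun_inl o\<^sub>L fst_blinfun) + (blinfun_inr o\<^sub>L G' z))"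
  have f'_apply: "blinfun_apply (f' z) h = (fst h, G' z h)" for z h
    by (simp add: f'_def blinfun.add_left)
  have derf: "(f has_derivative blinfun_apply (f' z)) (at z)" if "z \<in> S'" for z
  proof -
    have "(f has_derivative (\<lambda>h. (fst h, G' z h))) (at z)"
      unfolding f_def using that S' by (auto intro!: derivative_eq_intros G')
    moreover have "blinfun_apply (f' z) = (\<lambda>h. (fst h, G' z h))"
      using f'_apply by blast
    ultimately show ?thesis by simp
  qed
  have contf: "continuous_on S' f'"
    unfolding f'_def by (intro continuous_intros continuous_on_subset[OF cont S'(3)])
  define c where "c = G' (x0, y0) (0, 1)"
  \<comment> \<open>Inverse of the triangular derivative: \<open>(h, k)\<close> \<mapsto>
    \<open>(h, (k - G_x h) / c)\<close>.\<close>
  define invf where "invf = (blinfun_inl o\<^sub>L fst_blinfun) + (blinfun_inr o\<^sub>L ((1 / c) *\<^sub>R (snd_blinfun - (G' (x0, y0) o\<^sub>L blinfun_inl o\<^sub>L fst_blinfun))))"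
  have split: "G' z h = G' z (fst h, 0) + snd h * G' z (0, 1)" for z h
  proof -
    have "h = (fst h, 0) + snd h *\<^sub>R (0, 1)" by (simp add: prod_eq_iff)
    then have "G' z h = G' z ((fst h, 0) + snd h *\<^sub>R (0, 1))" by metis
    then show ?thesis by (simp only: blinfun.add_right blinfun.scaleR_right real_scaleR_def)
  qed
  have inv: "invf o\<^sub>L f' (x0, y0) = id_blinfun"
  proof (rule blinfun_eqI)
    fix h :: "'a \<times> real"
    have "G' (x0, y0) h - G' (x0, y0) (fst h, 0) = c * snd h"
      using split[of "(x0, y0)" h] by (simp add: c_def)
    moreover have "c \<noteq> 0" using z0 by (simp add: c_def)
    ultimately show "(invf o\<^sub>L f' (x0, y0)) h = id_blinfun h"
      by (simp add: invf_def f'_apply blinfun.add_left blinfun.diff_left blinfun.scaleR_left prod_eq_iff)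
  qed
  obtain W V k k' where W: "open W" "W \<subseteq> S'" "(x0, y0) \<in> W" and V: "open V" "f (x0, y0) \<in> V"
    and hom: "homeomorphism W V f k"
    and derk: "\<And>y. y \<in> V \<Longrightarrow> (k has_derivative (k' y)) (at y)"
    using inverse_function_theorem[OF S'(1) derf contf S'(2) inv] by metis
  define U where "U = (\<lambda>x. (x, 0::real)) -` V"
  define g where "g = (\<lambda>x. snd (k (x, 0)))"
  define g' where "g' = (\<lambda>x. (- 1 / G' (x, g x) (0, 1)) *\<^sub>R (G' (x, g x) o\<^sub>L blinfun_inl))"
  have U: "open U"
    unfolding U_def by (rule open_vimage[OF V(1)]) (intro continuous_intros)
  have kU: "k (x, 0) = (x, g x) \<and> (x, g x) \<in> W \<and> G (x, g x) = 0" if "x \<in> U" for x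
  proof -
    have "(x, 0) \<in> V" using that by (simp add: U_def)
    then have "f (k (x, 0)) = (x, 0)" "k (x, 0) \<in> W"
      using hom unfolding homeomorphism_def by auto
    then show ?thesis
      by (cases "k (x, 0)") (auto simp: f_def g_def)
  qed
  have derg: "(g has_derivative blinfun_apply (g' x)) (at x)" if "x \<in> U" for x
  proof -
    have xV: "(x, 0) \<in> V" using that by (simp add: U_def)
    \<comment> \<open>The inverse \<open>k\<close> only yields that \<open>g\<close> is
      differentiable. Its derivative is then identified by differentiating
      \<open>G (x, g x) = 0\<close>.\<close>
    have d1: "(g has_derivative (\<lambda>h. snd (k' (x, 0) (h, 0)))) (at x)"
      unfolding g_def
      by (rule derivative_eq_intros has_derivative_compose[where f = "\<lambda>x. (x, 0)" and g = k, OF _ derk[OF xV]] refl)+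
    then obtain L where L: "(g has_derivative L) (at x)" by blast
    have "(x, g x) \<in> S" using kU[OF that] W S' by blast
    then have "((\<lambda>x. G (x, g x)) has_derivative (\<lambda>h. G' (x, g x) (h, L h))) (at x)"
      by (intro has_derivative_compose[where f = "\<lambda>x. (x, g x)" and g = G, OF _ G'] has_derivative_Pair L has_derivative_ident)
    moreover have "((\<lambda>x. G (x, g x)) has_derivative (\<lambda>h. 0)) (at x)"
    proof (rule has_derivative_transform_within_open[OF _ U that])
      show "((\<lambda>x. 0) has_derivative (\<lambda>h. 0)) (at x)" by simp
    qed (use kU in auto)
    ultimately have "G' (x, g x) (h, L h) = 0" for h
      using has_derivative_unique by metis
    moreover have "G' (x, g x) (0, 1) \<noteq> 0" using kU[OF that] W S' by blast
    ultimately have "L h = g' x h" for h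
      using split[of "(x, g x)" "(h, L h)"]
      by (simp add: g'_def blinfun.scaleR_left blinfun.minus_left field_simps)
    then have "L = blinfun_apply (g' x)" by auto
    then show ?thesis using L by simp
  qed
  have contg: "continuous_on U (\<lambda>x. (x, g x))"
    by (intro continuous_intros has_derivative_continuous_on[where f' = g'])
      (use derg has_derivative_at_withinI in blast)
  have contG: "continuous_on U (\<lambda>x. G' (x, g x))"
    by (rule continuous_on_compose2[OF cont contg]) (use kU W S' in blast)
  have "continuous_on U g'"
    unfolding g'_def by (intro continuous_intros contG) (use kU W S' in blast)
  moreover have "k (f (x0, y0)) = (x0, y0)" using hom W unfolding homeomorphism_def by auto
  then have "g x0 = y0" "x0 \<in> U"
    using V z0 by (auto simp: U_def f_def g_def)
  ultimately show thesis
    using that[OF U] derg kU W S' by blast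
qed

section \<open>Classes C^k and smooth functions\<close>

lemma Ck_on_1I:
  assumes "\<And>x. x \<in> U \<Longrightarrow> (f has_derivative blinfun_apply (f' x)) (at x)" "continuous_on U f'"
  shows "Ck_on 1 U f"
proof -
  have "continuous_on U (\<lambda>x. f' x v)" for v
    by (intro continuous_intros assms)
  moreover have "frechet_derivative f (at x) = blinfun_apply (f' x)" if "x \<in> U" for x
    using frechet_derivative_at[OF assms(1)[OF that]] by simp
  ultimately have "continuous_on U (\<lambda>x. frechet_derivative f (at x) v)" for v
    by (simp cong: continuous_on_cong)
  then show ?thesis
    using assms(1) by (auto simp: differentiable_def)
qed

text \<open>The derivative as an element of the operator space, meaningful only at points of
  differentiability.\<close>

definition total_derivative :: "('a::euclidean_space \<Rightarrow> 'b::real_normed_vector) \<Rightarrow> 'a \<Rightarrow> 'a \<Rightarrow>\<^sub>L 'b"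
  where "total_derivative f x = Blinfun (frechet_derivative f (at x))"

lemma blinfun_apply_total_derivative:
  assumes "f differentiable (at x)"
  shows "blinfun_apply (total_derivative f x) = frechet_derivative f (at x)"
  using assms unfolding total_derivative_def frechet_derivative_works
  by (metis bounded_linear_Blinfun_apply has_derivative_bounded_linear)

lemma has_derivative_total_derivative:
  assumes "f differentiable (at x)"
  shows "(f has_derivative blinfun_apply (total_derivative f x)) (at x)"
  using assms by (simp add: blinfun_apply_total_derivative frechet_derivative_works)

text \<open>\<open>Ck_on\<close> gives continuity of the derivative in each fixed direction; in
  finite dimension, continuity on a basis already gives continuity in operator norm.\<close>

lemma Ck_on_1_continuous_total_derivative:
  assumes "Ck_on 1 U f"
  shows "continuous_on U (total_derivative f)"
proof (rule continuous_on_blinfun_componentwise)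
  fix i
  have "continuous_on U (\<lambda>x. frechet_derivative f (at x) i)"
    using assms by simp
  moreover have "f differentiable (at x)" if "x \<in> U" for x
    using assms that by simp
  ultimately show "continuous_on U (\<lambda>x. total_derivative f x i)"
    by (simp add: blinfun_apply_total_derivative cong: continuous_on_cong)
qed

lemma frechet_derivative_cong_open:
  assumes "open U" "x \<in> U" "\<And>y. y \<in> U \<Longrightarrow> f y = g y" "f differentiable (at x)"
  shows "g differentiable (at x)" "frechet_derivative g (at x) = frechet_derivative f (at x)"
proof -
  have "(f has_derivative frechet_derivative f (at x)) (at x)"
    using assms(4) by (simp add: frechet_derivative_works)
  then have g: "(g has_derivative frechet_derivative f (at x)) (at x)"
    using assms(1-3) by (rule has_derivative_transform_within_open)
  then show "g differentiable (at x)" by (auto simp: differentiable_def)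
  show "frechet_derivative g (at x) = frechet_derivative f (at x)"
    using frechet_derivative_at[OF g] by simp
qed

text \<open>Lets the pressures, which agree with a directional derivative of the energy only for
  positive volume, inherit its smoothness. Openness of \<open>U\<close> is what makes derivatives of
  every order depend on the values in \<open>U\<close> alone.\<close>

lemma Ck_on_cong:
  assumes "open U" "\<And>x. x \<in> U \<Longrightarrow> f x = g x" "Ck_on k U f"
  shows "Ck_on k U g"
  using assms(2,3)
proof (induction k arbitrary: f g)
  case 0
  then show ?case using continuous_on_cong[of U U f g] by simp
next
  case (Suc k)
  have diff: "f differentiable (at x)" if "x \<in> U" for x
    using Suc.prems(2) that by simp
  have "Ck_on k U (\<lambda>x. frechet_derivative g (at x) v)" for v
  proof (rule Suc.IH)
    show "Ck_on k U (\<lambda>x. frechet_derivative f (at x) v)"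
      using Suc.prems(2) by simp
    show "frechet_derivative f (at x) v = frechet_derivative g (at x) v" if "x \<in> U" for x
      using frechet_derivative_cong_open(2)[OF assms(1) that Suc.prems(1) diff[OF that]] by simp
  qed
  moreover have "g differentiable (at x)" if "x \<in> U" for x
    using frechet_derivative_cong_open(1)[OF assms(1) that Suc.prems(1) diff[OF that]] .
  ultimately show ?case by simp
qed

lemma Ck_on_uminus:
  assumes "open U" "Ck_on k U f"
  shows "Ck_on k U (\<lambda>x. - f x)"
  using assms(2)
proof (induction k arbitrary: f)
  case 0
  then show ?case by (simp add: continuous_on_minus)
next
  case (Suc k)
  have diff: "f differentiable (at x)" if "x \<in> U" for x
    using Suc.prems that by simp
  have "Ck_on k U (\<lambda>x. frechet_derivative (\<lambda>x. - f x) (at x) v)" for v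
  proof (rule Ck_on_cong[OF assms(1)])
    show "Ck_on k U (\<lambda>x. - frechet_derivative f (at x) v)"
      using Suc by simp
    fix x assume "x \<in> U"
    then have "((\<lambda>x. - f x) has_derivative (\<lambda>h. - frechet_derivative f (at x) h)) (at x)"
      using diff by (intro has_derivative_minus) (simp add: frechet_derivative_works)
    from frechet_derivative_at[OF this]
    show "- frechet_derivative f (at x) v = frechet_derivative (\<lambda>x. - f x) (at x) v" by metis
  qed
  then show ?case using diff by (simp add: differentiable_minus)
qed

lemma smooth_on_cong:
  "open U \<Longrightarrow> (\<And>x. x \<in> U \<Longrightarrow> f x = g x) \<Longrightarrow> smooth_on U f \<Longrightarrow> smooth_on U g"
  unfolding smooth_on_def using Ck_on_cong by metis

lemma smooth_on_uminus: "open U \<Longrightarrow> smooth_on U f \<Longrightarrow> smooth_on U (\<lambda>x. - f x)"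
  unfolding smooth_on_def using Ck_on_uminus by blast

lemma smooth_on_frechet_derivative:
  assumes "smooth_on U f"
  shows "smooth_on U (\<lambda>x. frechet_derivative f (at x) v)"
  unfolding smooth_on_def
proof
  fix k
  have "Ck_on (Suc k) U f" using assms unfolding smooth_on_def by blast
  then show "Ck_on k U (\<lambda>x. frechet_derivative f (at x) v)" by simp
qed

lemma smooth_on_imp_differentiable:
  assumes "smooth_on U f" "x \<in> U"
  shows "f differentiable (at x)"
proof -
  have "Ck_on (Suc 0) U f" using assms(1) unfolding smooth_on_def by blast
  then show ?thesis using assms(2) by simp
qed

lemma smooth_on_continuous_total_derivative: "smooth_on U f \<Longrightarrow> continuous_on U (total_derivative f)"
  unfolding smooth_on_def using Ck_on_1_continuous_total_derivative by blast

section \<open>Derivatives along curves and coordinate lines\<close>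

lemma has_real_derivative_compose_curve:
  assumes "(f has_derivative blinfun_apply L) (at x)" "(g has_vector_derivative v) (at t)" "g t = x"
  shows "((\<lambda>t. f (g t)) has_real_derivative L v) (at t)"
proof -
  have "((\<lambda>t. f (g t)) has_derivative (\<lambda>h. L (h *\<^sub>R v))) (at t)"
    using has_derivative_compose[of g _ t UNIV f] assms
    unfolding has_vector_derivative_def by blast
  moreover have "(\<lambda>h. L (h *\<^sub>R v)) = (*) (L v)"
    by (simp add: fun_eq_iff blinfun.scaleR_right mult.commute)
  ultimately show ?thesis by (simp add: has_field_derivative_def)
qed

lemma has_real_derivative_partial_fst:
  assumes "(f has_derivative blinfun_apply L) (at (t, s))"
  shows "((\<lambda>t. f (t, s)) has_real_derivative L (1, 0)) (at t)"
proof (rule has_real_derivative_compose_curve[OF assms, of "\<lambda>t. (t, s)"])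
  have "((\<lambda>t. (t, s)) has_derivative (\<lambda>h. (h, 0))) (at t)"
    by (intro has_derivative_Pair has_derivative_ident has_derivative_const)
  then show "((\<lambda>t. (t, s)) has_vector_derivative (1, 0)) (at t)"
    by (simp add: has_vector_derivative_def)
qed simp

lemma has_real_derivative_partial_snd:
  assumes "(f has_derivative blinfun_apply L) (at (s, t))"
  shows "((\<lambda>t. f (s, t)) has_real_derivative L (0, 1)) (at t)"
proof (rule has_real_derivative_compose_curve[OF assms, of "\<lambda>t. (s, t)"])
  have "((\<lambda>t. (s, t)) has_derivative (\<lambda>h. (0, h))) (at t)"
    by (intro has_derivative_Pair has_derivative_ident has_derivative_const)
  then show "((\<lambda>t. (s, t)) has_vector_derivative (0, 1)) (at t)"
    by (simp add: has_vector_derivative_def)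
qed simp

lemma has_vector_derivative_ray: "((\<lambda>r. (s + r *\<^sub>R a, t)) has_vector_derivative (a, 0)) (at r)"
  for s a :: "'a::real_normed_vector" and t :: "'b::real_normed_vector"
  by (auto simp: has_vector_derivative_def intro!: derivative_eq_intros)

lemma C1_on_imp_continuous_on:
  assumes "C1_on A f"
  shows "continuous_on A f"
  unfolding continuous_on_eq_continuous_within
proof
  fix x assume x: "x \<in> A"
  then have "\<exists>U g. open U \<and> x \<in> U \<and> Ck_on 1 U g \<and> (\<forall>y\<in>A \<inter> U. g y = f y)"
    using assms by (simp only: C1_on_def)
  then obtain U g where U: "open U" "x \<in> U" "Ck_on 1 U g" "\<forall>y\<in>A \<inter> U. g y = f y"
    by (elim exE conjE)
  have "g differentiable (at x)" using U(2,3) by simp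
  then have "continuous (at x within A) g"
    using differentiable_imp_continuous_within continuous_at_imp_continuous_at_within by blast
  then have "(g \<longlongrightarrow> f x) (at x within A)"
    using U(2,4) x by (simp add: continuous_within)
  moreover have "eventually (\<lambda>y. g y = f y) (at x within A)"
    unfolding eventually_at_topological using U by blast
  ultimately show "continuous (at x within A) f"
    unfolding continuous_within by (rule Lim_transform_eventually)
qed

section \<open>The roots of F and H along rays\<close>

text \<open>Isolates what the argument uses about \<open>F\<close> and \<open>H\<close>. The
  derivatives take \<open>(s, t)\<close> with the volume last, since this is the coordinate that
  \<open>implicit_function_real\<close> solves for. \<open>F'_tau_mono\<close> is strict convexity
  in the volume, \<open>F'_L\<close> is the Lax condition, and \<open>H_ray\<close> bounds the
  admissible part of each ray.\<close>

locale hugoniot =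
  fixes F H :: "real \<Rightarrow> real ^ 'n::finite \<Rightarrow> real"
    and F' H' :: "(real ^ 'n) \<times> real \<Rightarrow> ((real ^ 'n) \<times> real) \<Rightarrow>\<^sub>L real"
    and \<tau>\<^sub>L :: real and s\<^sub>L :: "real ^ 'n"
  assumes F_deriv: "\<And>s t. 0 < t \<Longrightarrow> ((\<lambda>z. F (snd z) (fst z)) has_derivative blinfun_apply (F' (s, t))) (at (s, t))"
    and H_deriv: "\<And>s t. 0 < t \<Longrightarrow> ((\<lambda>z. H (snd z) (fst z)) has_derivative blinfun_apply (H' (s, t))) (at (s, t))"
    and cont_F': "continuous_on (UNIV \<times> {0<..}) F'"
    and cont_H': "continuous_on (UNIV \<times> {0<..}) H'"
    and F'_tau_mono: "\<And>s t u. 0 < t \<Longrightarrow> t < u \<Longrightarrow> F' (s, t) (0, 1) < F' (s, u) (0, 1)"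
    and H'_tau: "\<And>s t. 0 < t \<Longrightarrow> H' (s, t) (0, 1) = - F t s"
    and F'_s_pos: "\<And>s t a. 0 < t \<Longrightarrow> a \<in> pos_sphere \<Longrightarrow> 0 < F' (s, t) (a, 0)"
    and H'_s_pos: "\<And>s t a. 0 < t \<Longrightarrow> a \<in> pos_sphere \<Longrightarrow> 0 < H' (s, t) (a, 0)"
    and tau_L_pos: "0 < \<tau>\<^sub>L"
    and F_L: "F \<tau>\<^sub>L s\<^sub>L = 0"
    and H_L: "H \<tau>\<^sub>L s\<^sub>L = 0"
    and F'_L: "0 < F' (s\<^sub>L, \<tau>\<^sub>L) (0, 1)"
    and F_at_0: "filterlim (\<lambda>t. F t s\<^sub>L) at_top (at_right 0)"
    and H_ray: "\<And>a. a \<in> pos_sphere \<Longrightarrow> \<exists>r>0. \<forall>t\<in>{0<..\<tau>\<^sub>L}. 0 < H t (s\<^sub>L + r *\<^sub>R a)"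
begin

lemma DERIV_F: "((\<lambda>t. F t s) has_real_derivative F' (s, t) (0, 1)) (at t)" if "0 < t"
  using has_real_derivative_partial_snd[OF F_deriv[OF that]] by simp

lemma DERIV_H: "((\<lambda>t. H t s) has_real_derivative - F t s) (at t)" if "0 < t"
  using has_real_derivative_partial_snd[OF H_deriv[OF that]] H'_tau[OF that] by simp

lemma DERIV_F_ray: "((\<lambda>r. F t (s + r *\<^sub>R a)) has_real_derivative F' (s + r *\<^sub>R a, t) (a, 0)) (at r)" if "0 < t"
  using has_real_derivative_compose_curve[OF F_deriv[OF that] has_vector_derivative_ray refl] by simp

lemma DERIV_H_ray: "((\<lambda>r. H t (s + r *\<^sub>R a)) has_real_derivative H' (s + r *\<^sub>R a, t) (a, 0)) (at r)" if "0 < t"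
  using has_real_derivative_compose_curve[OF H_deriv[OF that] has_vector_derivative_ray refl] by simp

lemma cont_F: "continuous_on (UNIV \<times> {0<..}) (\<lambda>z. F (snd z) (fst z))"
  by (rule has_derivative_continuous_on[where f' = "\<lambda>z. F' z"])
    (use F_deriv has_derivative_at_withinI in fastforce)

lemma cont_H: "continuous_on (UNIV \<times> {0<..}) (\<lambda>z. H (snd z) (fst z))"
  by (rule has_derivative_continuous_on[where f' = "\<lambda>z. H' z"])
    (use H_deriv has_derivative_at_withinI in fastforce)

lemma cont_F_compose [continuous_intros]:
  assumes "continuous_on A f" "continuous_on A g" "\<And>x. x \<in> A \<Longrightarrow> 0 < f x"
  shows "continuous_on A (\<lambda>x. F (f x) (g x))"
  using continuous_on_compose2[OF cont_F continuous_on_Pair[OF assms(2,1)]] assms(3) by auto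

lemma cont_H_compose [continuous_intros]:
  assumes "continuous_on A f" "continuous_on A g" "\<And>x. x \<in> A \<Longrightarrow> 0 < f x"
  shows "continuous_on A (\<lambda>x. H (f x) (g x))"
  using continuous_on_compose2[OF cont_H continuous_on_Pair[OF assms(2,1)]] assms(3) by auto

lemma F_ray_mono: "F t (s + r *\<^sub>R a) < F t (s + r' *\<^sub>R a)"
  if "0 < t" "a \<in> pos_sphere" "r < r'"
  using DERIV_pos_imp_increasing[OF that(3), of "\<lambda>r. F t (s + r *\<^sub>R a)"]
    DERIV_F_ray F'_s_pos that by blast

lemma H_ray_mono: "H t (s + r *\<^sub>R a) < H t (s + r' *\<^sub>R a)"
  if "0 < t" "a \<in> pos_sphere" "r < r'"
  using DERIV_pos_imp_increasing[OF that(3), of "\<lambda>r. H t (s + r *\<^sub>R a)"]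
    DERIV_H_ray H'_s_pos that by blast

section \<open>Convexity of F and monotonicity of H in the volume\<close>

lemma F_mvt:
  assumes "0 < t" "t < u"
  obtains \<xi> where "t < \<xi>" "\<xi> < u" "F u s - F t s = (u - t) * F' (s, \<xi>) (0, 1)"
proof -
  have "((\<lambda>t. F t s) has_real_derivative F' (s, x) (0, 1)) (at x)" if "t \<le> x" "x \<le> u" for x
    using that assms by (intro DERIV_F) simp
  from MVT2[OF assms(2) this] show thesis using that by blast
qed

text \<open>Otherwise the mean slope would be nonnegative before \<open>u\<close> and nonpositive
  after it, although the slope increases strictly.\<close>

lemma F_convex_neg:
  assumes "0 < t" "t < u" "u < v" "F t s \<le> 0" "F v s \<le> 0"
  shows "F u s < 0"
proof (rule ccontr)
  assume nonneg: "\<not> ?thesis"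
  obtain \<xi> where \<xi>: "t < \<xi>" "\<xi> < u" "F u s - F t s = (u - t) * F' (s, \<xi>) (0, 1)"
    using F_mvt assms by blast
  obtain \<eta> where \<eta>: "u < \<eta>" "\<eta> < v" "F v s - F u s = (v - u) * F' (s, \<eta>) (0, 1)"
    using F_mvt[of u v s] assms by auto
  have "0 \<le> (u - t) * F' (s, \<xi>) (0, 1)" "(v - u) * F' (s, \<eta>) (0, 1) \<le> 0"
    using \<xi>(3) \<eta>(3) assms nonneg by linarith+
  then have "0 \<le> F' (s, \<xi>) (0, 1)" "F' (s, \<eta>) (0, 1) \<le> 0"
    using assms by (simp_all add: zero_le_mult_iff mult_le_0_iff)
  moreover have "F' (s, \<xi>) (0, 1) < F' (s, \<eta>) (0, 1)"
    using \<xi> \<eta> assms by (intro F'_tau_mono) auto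
  ultimately show False by linarith
qed

text \<open>Past \<open>t\<close> the slope exceeds its nonnegative value at \<open>t\<close>, so
  \<open>F\<close> rises. \<open>F_pos_left\<close> is the mirror image.\<close>

lemma F_pos_right:
  assumes "0 < t" "t < u" "0 \<le> F t s" "0 \<le> F' (s, t) (0, 1)"
  shows "0 < F u s"
proof -
  obtain \<xi> where \<xi>: "t < \<xi>" "\<xi> < u" "F u s - F t s = (u - t) * F' (s, \<xi>) (0, 1)"
    using F_mvt assms by blast
  moreover have "0 < F' (s, \<xi>) (0, 1)" using F'_tau_mono[of t \<xi> s] \<xi> assms by linarith
  ultimately have "0 < F u s - F t s" using assms by simp
  then show ?thesis using assms by simp
qed

lemma F_pos_left:
  assumes "0 < v" "v < t" "0 \<le> F t s" "F' (s, t) (0, 1) \<le> 0"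
  shows "0 < F v s"
proof -
  obtain \<xi> where \<xi>: "v < \<xi>" "\<xi> < t" "F t s - F v s = (t - v) * F' (s, \<xi>) (0, 1)"
    using F_mvt assms by blast
  moreover have "F' (s, \<xi>) (0, 1) < 0" using F'_tau_mono[of \<xi> t s] \<xi> assms by linarith
  ultimately have "F t s - F v s < 0" using assms by (simp add: mult_pos_neg)
  then show ?thesis using assms by simp
qed

text \<open>By \<open>F_convex_neg\<close>, \<open>F\<close> is negative strictly between the two
  points, and the slope of \<open>H\<close> is \<open>- F\<close>.\<close>

lemma H_increasing:
  assumes "0 < t" "t < u" "F t s \<le> 0" "F u s \<le> 0"
  shows "H t s < H u s"
proof (rule DERIV_pos_imp_increasing_open[OF assms(2)])
  show "\<exists>y. ((\<lambda>t. H t s) has_real_derivative y) (at x) \<and> 0 < y" if "t < x" "x < u" for x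
    using DERIV_H[of x s] F_convex_neg[of t x u s] assms that by force
  show "continuous_on {t..u} (\<lambda>t. H t s)"
    using assms by (intro continuous_intros) auto
qed

lemma H_decreasing:
  assumes "0 < t" "t < u" "\<And>x. t < x \<Longrightarrow> x < u \<Longrightarrow> 0 < F x s"
  shows "H u s < H t s"
proof (rule DERIV_neg_imp_decreasing_open[OF assms(2)])
  show "\<exists>y. ((\<lambda>t. H t s) has_real_derivative y) (at x) \<and> y < 0" if "t < x" "x < u" for x
    using DERIV_H[of x s] assms that by force
  show "continuous_on {t..u} (\<lambda>t. H t s)"
    using assms by (intro continuous_intros) auto
qed

lemma root_unique:
  assumes "0 < t" "F t s \<le> 0" "H t s = 0" "0 < u" "F u s \<le> 0" "H u s = 0"
  shows "t = u"
  using H_increasing[of t u s] H_increasing[of u t s] assms by (cases t u rule: linorder_cases) auto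

text \<open>As \<open>F\<close> increases along rays, \<open>F\<close> \<le> 0 at a point of a ray
  forces \<open>F\<close> \<le> 0 at \<open>s\<^sub>L\<close> for the same volume. One pair of
  bounds thus serves all rays: the lower one comes from the blow-up of \<open>F\<close> at zero
  volume, the upper one from the positive slope at \<open>\<tau>\<^sub>L\<close>. They supply the
  compactness used later.\<close>

lemma F_neg_bounds:
  obtains \<delta> where "0 < \<delta>"
    "\<And>t r a. 0 < t \<Longrightarrow> 0 \<le> r \<Longrightarrow> a \<in> pos_sphere \<Longrightarrow> F t (s\<^sub>L + r *\<^sub>R a) \<le> 0 \<Longrightarrow> \<delta> \<le> t \<and> t \<le> \<tau>\<^sub>L"
proof -
  have "eventually (\<lambda>t. 0 < F t s\<^sub>L) (at_right 0)"
    using F_at_0 by (simp add: filterlim_at_top_dense)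
  then obtain \<delta> where \<delta>: "0 < \<delta>" "\<And>t. 0 < t \<Longrightarrow> t < \<delta> \<Longrightarrow> 0 < F t s\<^sub>L"
    by (auto simp: eventually_at_right_field)
  show thesis
  proof (rule that[OF \<delta>(1)])
    fix t r :: real and a :: "real ^ 'n"
    assume *: "0 < t" "0 \<le> r" "a \<in> pos_sphere" "F t (s\<^sub>L + r *\<^sub>R a) \<le> 0"
    have "F t s\<^sub>L \<le> 0"
      using F_ray_mono[of t a 0 r s\<^sub>L] * by (cases "r = 0") auto
    then show "\<delta> \<le> t \<and> t \<le> \<tau>\<^sub>L"
      using \<delta>(2)[of t] F_pos_right[OF tau_L_pos, of t s\<^sub>L] F_L F'_L * by force
  qed
qed

section \<open>The end point of the root on a ray\<close>

text \<open>The root has reached the left end of {F \<le> 0}. The sign of the slope excludes the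
  starting point \<open>(s\<^sub>L, \<tau>\<^sub>L)\<close>, where \<open>F\<close> and
  \<open>H\<close> vanish as well.\<close>

definition crit :: "real ^ 'n \<Rightarrow> real \<Rightarrow> bool"
  where "crit s t \<longleftrightarrow> 0 < t \<and> F t s = 0 \<and> H t s = 0 \<and> F' (s, t) (0, 1) < 0"

lemma crit_below:
  assumes "crit (s\<^sub>L + R *\<^sub>R a) t" "a \<in> pos_sphere" "r < R"
  shows "F t (s\<^sub>L + r *\<^sub>R a) < 0" "H t (s\<^sub>L + r *\<^sub>R a) < 0"
  using assms F_ray_mono[of t a r R s\<^sub>L] H_ray_mono[of t a r R s\<^sub>L] by (auto simp: crit_def)

text \<open>At radius \<open>R\<close>, \<open>F\<close> is negative at \<open>u\<close>. Since
  \<open>F\<close> is positive to the left of its zero \<open>t\<close>, \<open>u\<close> lies to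
  the right of \<open>t\<close> or equals it, and \<open>H\<close> has grown from 0 at
  \<open>t\<close>. Moving outwards along the ray increases \<open>H\<close> strictly.\<close>

lemma crit_above:
  assumes "crit (s\<^sub>L + R *\<^sub>R a) t" "a \<in> pos_sphere" "R < r" "0 < u" "F u (s\<^sub>L + r *\<^sub>R a) \<le> 0"
  shows "0 < H u (s\<^sub>L + r *\<^sub>R a)"
proof -
  have u: "F u (s\<^sub>L + R *\<^sub>R a) < 0"
    using F_ray_mono[of u a R r s\<^sub>L] assms by auto
  then have "t \<le> u"
    using F_pos_left[of u t "s\<^sub>L + R *\<^sub>R a"] assms by (force simp: crit_def)
  then have "0 \<le> H u (s\<^sub>L + R *\<^sub>R a)"
    using H_increasing[of t u "s\<^sub>L + R *\<^sub>R a"] u assms by (cases "t = u") (auto simp: crit_def)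
  then show ?thesis
    using H_ray_mono[of u a R r s\<^sub>L] assms by auto
qed

lemma crit_radius_unique:
  assumes "crit (s\<^sub>L + R *\<^sub>R a) t" "crit (s\<^sub>L + R' *\<^sub>R a) t'" "a \<in> pos_sphere"
  shows "R = R'"
  using crit_above[OF assms(1,3), of R' t'] crit_above[OF assms(2,3), of R t] assms
  by (cases R R' rule: linorder_cases) (auto simp: crit_def)

text \<open>Maximise \<open>r\<close> over the compact set \<open>X\<close> of pairs
  \<open>(r, t)\<close> with \<open>F\<close> \<le> 0 and \<open>H\<close> \<le> 0. At a maximiser
  \<open>(R, t)\<close> no volume can make both functions negative, and perturbing \<open>t\<close>
  to either side then yields every clause of \<open>crit\<close>.\<close>

lemma ex_crit:
  assumes a: "a \<in> pos_sphere"
  shows "\<exists>R>0. \<exists>t. crit (s\<^sub>L + R *\<^sub>R a) t"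
proof -
  obtain \<delta> where \<delta>: "0 < \<delta>"
    "\<And>t r. 0 < t \<Longrightarrow> 0 \<le> r \<Longrightarrow> F t (s\<^sub>L + r *\<^sub>R a) \<le> 0 \<Longrightarrow> \<delta> \<le> t \<and> t \<le> \<tau>\<^sub>L"
    using F_neg_bounds a by metis
  obtain r1 where r1: "0 < r1" "\<And>t. 0 < t \<Longrightarrow> t \<le> \<tau>\<^sub>L \<Longrightarrow> 0 < H t (s\<^sub>L + r1 *\<^sub>R a)"
    using H_ray[OF a] by auto
  define Q where "Q = {0..r1} \<times> {\<delta>..\<tau>\<^sub>L}"
  have contF: "continuous_on Q (\<lambda>(r, t). F t (s\<^sub>L + r *\<^sub>R a))"
    unfolding case_prod_beta Q_def using \<delta> by (intro continuous_intros) auto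
  have contH: "continuous_on Q (\<lambda>(r, t). H t (s\<^sub>L + r *\<^sub>R a))"
    unfolding case_prod_beta Q_def using \<delta> by (intro continuous_intros) auto
  define X where "X = {z \<in> Q. (\<lambda>(r, t). F t (s\<^sub>L + r *\<^sub>R a)) z \<le> 0} \<inter> {z \<in> Q. (\<lambda>(r, t). H t (s\<^sub>L + r *\<^sub>R a)) z \<le> 0}"
  have "compact Q" unfolding Q_def by (intro compact_Times compact_Icc)
  then have "closed Q" using compact_imp_closed by blast
  have "closed {z \<in> Q. (\<lambda>(r, t). F t (s\<^sub>L + r *\<^sub>R a)) z \<le> 0}" "closed {z \<in> Q. (\<lambda>(r, t). H t (s\<^sub>L + r *\<^sub>R a)) z \<le> 0}"
    using continuous_on_closed_Collect_le[OF contF continuous_on_const \<open>closed Q\<close>]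
      continuous_on_closed_Collect_le[OF contH continuous_on_const \<open>closed Q\<close>] by blast+
  then have "closed X" unfolding X_def by blast
  moreover have "X = Q \<inter> X" unfolding X_def by blast
  ultimately have "compact X" using compact_Int_closed[OF \<open>compact Q\<close>] by metis
  \<comment> \<open>The box \<open>Q\<close> is no restriction: \<open>F\<close> \<le> 0 confines
    the volume, and beyond \<open>r1\<close> the growth of \<open>H\<close> along the ray makes it
    positive.\<close>
  have X: "(r, t) \<in> X" if "0 \<le> r" "0 < t" "F t (s\<^sub>L + r *\<^sub>R a) \<le> 0" "H t (s\<^sub>L + r *\<^sub>R a) \<le> 0" for r t
  proof -
    have t: "\<delta> \<le> t" "t \<le> \<tau>\<^sub>L" using \<delta>(2)[of t r] that by auto
    have "r \<le> r1"
    proof (rule ccontr)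
      assume "\<not> r \<le> r1"
      then have "H t (s\<^sub>L + r1 *\<^sub>R a) < H t (s\<^sub>L + r *\<^sub>R a)"
        using H_ray_mono that(2) a by simp
      then show False using r1(2)[OF that(2) t(2)] that(4) by linarith
    qed
    then show ?thesis unfolding X_def Q_def using t that by auto
  qed
  have "(0, \<tau>\<^sub>L) \<in> X" using X[of 0 \<tau>\<^sub>L] tau_L_pos F_L H_L by simp
  then obtain z where z: "z \<in> X" "\<And>y. y \<in> X \<Longrightarrow> fst y \<le> fst z"
    using continuous_attains_sup[OF \<open>compact X\<close> _ continuous_on_fst[OF continuous_on_id]] by blast
  obtain R t where zRt: "z = (R, t)" by (cases z)
  define s where "s = s\<^sub>L + R *\<^sub>R a"
  have R: "0 \<le> R" and t: "0 < t" "t \<le> \<tau>\<^sub>L" and Ft: "F t s \<le> 0" and Ht: "H t s \<le> 0"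
    using z(1) \<delta>(1) unfolding zRt X_def Q_def s_def by auto
  \<comment> \<open>Two strict inequalities would survive a small increase of the radius, against
    maximality of \<open>R\<close>.\<close>
  have no_neg: False if "0 < u" "F u s < 0" "H u s < 0" for u
  proof -
    have "((\<lambda>r. F u (s\<^sub>L + r *\<^sub>R a)) \<longlongrightarrow> F u s) (at_right R)"
      using DERIV_isCont[OF DERIV_F_ray[OF that(1), of s\<^sub>L a R]] unfolding s_def isCont_def
      by (rule tendsto_mono[rotated]) (rule at_within_le_at)
    then have 1: "eventually (\<lambda>r. F u (s\<^sub>L + r *\<^sub>R a) < 0) (at_right R)"
      using that order_tendstoD(2) by blast
    have "((\<lambda>r. H u (s\<^sub>L + r *\<^sub>R a)) \<longlongrightarrow> H u s) (at_right R)"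
      using DERIV_isCont[OF DERIV_H_ray[OF that(1), of s\<^sub>L a R]] unfolding s_def isCont_def
      by (rule tendsto_mono[rotated]) (rule at_within_le_at)
    then have 2: "eventually (\<lambda>r. H u (s\<^sub>L + r *\<^sub>R a) < 0) (at_right R)"
      using that order_tendstoD(2) by blast
    have "eventually (\<lambda>r. R < r) (at_right R)" by (simp add: eventually_at_right_less)
    with 1 2 have "eventually (\<lambda>r. R < r \<and> F u (s\<^sub>L + r *\<^sub>R a) < 0 \<and> H u (s\<^sub>L + r *\<^sub>R a) < 0) (at_right R)"
      by eventually_elim auto
    then obtain r where "R < r" "F u (s\<^sub>L + r *\<^sub>R a) < 0" "H u (s\<^sub>L + r *\<^sub>R a) < 0"
      using eventually_happens trivial_limit_at_right_real by blast
    then show False using X[of r u] z(2)[of "(r, u)"] R that(1) zRt by auto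
  qed
  have contFt: "((\<lambda>u. F u s) \<longlongrightarrow> F t s) (at t)" and contHt: "((\<lambda>u. H u s) \<longlongrightarrow> H t s) (at t)"
    using DERIV_isCont[OF DERIV_F[OF t(1)]] DERIV_isCont[OF DERIV_H[OF t(1)]] unfolding isCont_def by auto
  \<comment> \<open>Otherwise a slightly smaller volume keeps \<open>F\<close> negative and makes
    \<open>H\<close> strictly smaller, hence negative.\<close>
  have no_F_neg: "\<not> F t s < 0"
  proof
    assume "F t s < 0"
    then have "eventually (\<lambda>u. F u s < 0) (at_left t)"
      using order_tendstoD(2)[OF contFt, of 0] filter_leD[OF at_within_le_at] by blast
    moreover have "eventually (\<lambda>u. 0 < u \<and> u < t) (at_left t)"
      using eventually_at_left_real[OF t(1)] by (auto elim: eventually_mono)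
    ultimately have "eventually (\<lambda>u. F u s < 0 \<and> 0 < u \<and> u < t) (at_left t)"
      by eventually_elim auto
    then obtain u where u: "F u s < 0" "0 < u" "u < t"
      using eventually_happens trivial_limit_at_left_real by blast
    then have "H u s < 0" using H_increasing[of u t s] Ft Ht by linarith
    then show False using no_neg u by blast
  qed
  then have Ft0: "F t s = 0" using Ft by simp
  \<comment> \<open>With a nonnegative slope, \<open>F\<close> is positive to the right of
    \<open>t\<close>, so \<open>H\<close> decreases from \<open>t\<close> to
    \<open>\<tau>\<^sub>L\<close>; it also increases along the ray from \<open>s\<^sub>L\<close>.
    Since \<open>H\<close> vanishes at \<open>(\<tau>\<^sub>L, s\<^sub>L)\<close> and is at most 0
    at \<open>(t, s)\<close>, the two points coincide. There the Lax condition makes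
    \<open>F\<close> and \<open>H\<close> negative just left of
    \<open>\<tau>\<^sub>L\<close>.\<close>
  have F't: "F' (s, t) (0, 1) < 0"
  proof (rule ccontr)
    assume "\<not> ?thesis"
    then have pos: "0 < F u s" if "t < u" for u
      using F_pos_right[of t u s] that t Ft0 by auto
    have "R = 0 \<and> t = \<tau>\<^sub>L"
    proof (rule ccontr)
      assume "\<not> (R = 0 \<and> t = \<tau>\<^sub>L)"
      then have "H \<tau>\<^sub>L s\<^sub>L < H t s"
      proof -
        have "H \<tau>\<^sub>L s < H t s" if "t \<noteq> \<tau>\<^sub>L"
          using H_decreasing[of t \<tau>\<^sub>L s] pos t that by simp
        moreover have "H \<tau>\<^sub>L s\<^sub>L < H \<tau>\<^sub>L s" if "R \<noteq> 0"
          using H_ray_mono[OF tau_L_pos a, of 0 R s\<^sub>L] R that by (simp add: s_def)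
        moreover have "s = s\<^sub>L" if "R = 0"
          using that by (simp add: s_def)
        ultimately show ?thesis
          using \<open>\<not> (R = 0 \<and> t = \<tau>\<^sub>L)\<close> by (cases "R = 0"; cases "t = \<tau>\<^sub>L") simp_all
      qed
      then show False using H_L Ht by simp
    qed
    then have st: "s = s\<^sub>L" "t = \<tau>\<^sub>L" by (auto simp: s_def)
    obtain d where d: "0 < d" "\<And>h. 0 < h \<Longrightarrow> h < d \<Longrightarrow> F (t - h) s < F t s"
      using DERIV_pos_inc_left[OF DERIV_F[OF t(1), of s]] F'_L st by metis
    \<comment> \<open>Half of \<open>d\<close> keeps \<open>u\<close> where \<open>F\<close> is
      below its value at \<open>t\<close>; half of \<open>t\<close> keeps \<open>u\<close>
      positive.\<close>
    define u where "u = t - min (d / 2) (t / 2)"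
    have u: "0 < u" "u < t" "F u s < 0"
      using d t Ft0 unfolding u_def by (auto simp: min_def)
    then have "H u s < 0" using H_increasing[of u t s] Ft Ht by linarith
    then show False using no_neg u by blast
  qed
  \<comment> \<open>If \<open>H\<close> were negative at \<open>t\<close>, it would stay so slightly
    to the right, where the negative slope makes \<open>F\<close> negative too.\<close>
  have Ht0: "H t s = 0"
  proof (rule ccontr)
    assume "H t s \<noteq> 0"
    then have "H t s < 0" using Ht by simp
    then have ev: "eventually (\<lambda>u. H u s < 0) (at_right t)"
      using order_tendstoD(2)[OF contHt, of 0] filter_leD[OF at_within_le_at] by blast
    obtain d where d: "0 < d" "\<And>h. 0 < h \<Longrightarrow> h < d \<Longrightarrow> F t s > F (t + h) s"
      using DERIV_neg_dec_right[OF DERIV_F[OF t(1), of s] F't] by blast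
    have "eventually (\<lambda>u. t < u \<and> u < t + d) (at_right t)"
      using eventually_at_right_real[of t "t + d"] d(1) by (auto elim: eventually_mono)
    with ev have "eventually (\<lambda>u. H u s < 0 \<and> t < u \<and> u < t + d) (at_right t)"
      by eventually_elim auto
    then obtain u where u: "H u s < 0" "t < u" "u < t + d"
      using eventually_happens trivial_limit_at_right_real by blast
    then have "F u s < 0" using d(2)[of "u - t"] Ft0 by simp
    then show False using no_neg[of u] u t by simp
  qed
  have c: "crit (s\<^sub>L + R *\<^sub>R a) t" using t Ft0 Ht0 F't by (simp add: crit_def s_def)
  \<comment> \<open>At \<open>s\<^sub>L\<close> the only root with \<open>F\<close> \<le> 0 is
    \<open>\<tau>\<^sub>L\<close>, and there the slope is positive.\<close>
  have "R \<noteq> 0"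
  proof
    assume "R = 0"
    then have "s = s\<^sub>L" by (simp add: s_def)
    then have "t = \<tau>\<^sub>L" using root_unique[of t s \<tau>\<^sub>L] t Ft0 Ht0 F_L H_L tau_L_pos by auto
    then show False using F't F'_L \<open>s = s\<^sub>L\<close> by simp
  qed
  then show ?thesis using R c by (auto simp: less_le)
qed

section \<open>The radius function and its regularity\<close>

definition radius :: "real ^ 'n \<Rightarrow> real"
  where "radius a = (THE R. 0 < R \<and> (\<exists>t. crit (s\<^sub>L + R *\<^sub>R a) t))"

lemma radius_eqI:
  assumes "0 < R" "crit (s\<^sub>L + R *\<^sub>R a) t" "a \<in> pos_sphere"
  shows "radius a = R"
  unfolding radius_def using assms crit_radius_unique by (intro the_equality) blast+

lemma radius:
  assumes "a \<in> pos_sphere"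
  shows "0 < radius a" "\<exists>t. crit (s\<^sub>L + radius a *\<^sub>R a) t"
  using ex_crit[OF assms] radius_eqI assms by metis+

lemma C1_radius: "C1_on pos_sphere radius"
  unfolding C1_on_def
proof
  fix a0 :: "real ^ 'n"
  assume a0: "a0 \<in> pos_sphere"
  define R where "R = radius a0"
  define s0 where "s0 = s\<^sub>L + R *\<^sub>R a0"
  have R: "0 < R" using radius a0 by (simp add: R_def)
  obtain t0 where t0: "crit s0 t0" using radius(2)[OF a0] by (auto simp: s0_def R_def)
  define S where "S = (UNIV :: (real ^ 'n) set) \<times> {0::real<..}"
  have "open S" unfolding S_def by (intro open_Times) auto
  have contF': "continuous_on S F'" and contH': "continuous_on S H'"
    unfolding S_def by (rule cont_F' cont_H')+
  have derS: "((\<lambda>z. F (snd z) (fst z)) has_derivative blinfun_apply (F' z)) (at z)"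
      "((\<lambda>z. H (snd z) (fst z)) has_derivative blinfun_apply (H' z)) (at z)" if "z \<in> S" for z
    using that F_deriv[of "snd z" "fst z"] H_deriv[of "snd z" "fst z"] unfolding S_def by (cases z; auto)+
  have z0: "(s0, t0) \<in> S" "F (snd (s0, t0)) (fst (s0, t0)) = 0" "F' (s0, t0) (0, 1) \<noteq> 0"
    using t0 by (auto simp: crit_def S_def)
  obtain U g g' where U: "open U" "s0 \<in> U" and g0: "g s0 = t0"
    and g': "\<And>s. s \<in> U \<Longrightarrow> (g has_derivative blinfun_apply (g' s)) (at s)" "continuous_on U g'"
    and g: "\<And>s. s \<in> U \<Longrightarrow> (s, g s) \<in> S" "\<And>s. s \<in> U \<Longrightarrow> F (snd (s, g s)) (fst (s, g s)) = 0"
    by (rule implicit_function_real[OF \<open>open S\<close> derS(1) contF' z0], assumption, (rule that; (assumption | simp)))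
  have contg: "continuous_on U (\<lambda>s. (s, g s))"
    by (intro continuous_intros has_derivative_continuous_on[where f' = g'])
      (use g'(1) has_derivative_at_withinI in blast)
  have contH'g: "continuous_on U (\<lambda>s. H' (s, g s))" and contF'g: "continuous_on U (\<lambda>s. F' (s, g s) (0, 1))"
    by (intro continuous_intros continuous_on_compose2[OF contH' contg] continuous_on_compose2[OF contF' contg];
        use g in blast)+
  \<comment> \<open>Keeping the slope negative ensures that nearby solutions of
    \<open>F = H = 0\<close> are again critical points.\<close>
  define U1 where "U1 = U \<inter> (\<lambda>s. F' (s, g s) (0, 1)) -` {..<0}"
  have U1: "open U1" "s0 \<in> U1" "U1 \<subseteq> U"
    unfolding U1_def using continuous_open_preimage[OF contF'g U(1)] U(2) g0 t0
    by (auto simp: crit_def)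
  define \<phi>' where "\<phi>' = (\<lambda>s. H' (s, g s) o\<^sub>L (blinfun_inl :: _ \<Rightarrow>\<^sub>L (_ \<times> real)))"
  \<comment> \<open>the derivative of \<open>g\<close> drops out because \<open>H_\<tau> = - F\<close> vanishes along \<open>g\<close>\<close>
  have \<phi>: "((\<lambda>s. H (g s) s) has_derivative blinfun_apply (\<phi>' s)) (at s)" if "s \<in> U" for s
  proof -
    have "((\<lambda>s. (s, g s)) has_derivative (\<lambda>h. (h, g' s h))) (at s)"
      using g'(1)[OF that] by (intro has_derivative_Pair has_derivative_ident)
    from has_derivative_compose[OF this derS(2)[OF g(1)[OF that]]]
    have "((\<lambda>s. H (g s) s) has_derivative (\<lambda>h. H' (s, g s) (h, g' s h))) (at s)"
      by simp
    moreover have "H' (s, g s) (h, g' s h) = \<phi>' s h" for h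
    proof -
      have "(h, g' s h) = (h, 0) + g' s h *\<^sub>R (0, 1)" by simp
      then have "H' (s, g s) (h, g' s h) = H' (s, g s) (h, 0) + g' s h * H' (s, g s) (0, 1)"
        by (simp only: blinfun.add_right blinfun.scaleR_right real_scaleR_def)
      moreover have "H' (s, g s) (0, 1) = 0"
        using H'_tau[of "g s" s] g[OF that] by (simp add: S_def)
      ultimately show ?thesis by (simp add: \<phi>'_def)
    qed
    ultimately show ?thesis by simp
  qed
  have cont\<phi>': "continuous_on U \<phi>'"
    unfolding \<phi>'_def by (intro continuous_intros contH'g)
  \<comment> \<open>Ray coordinates, with the direction ranging over the whole space because the
    implicit function theorem needs an open domain. The restriction to the sphere is made only when
    \<open>l\<close> is compared with \<open>radius\<close>.\<close>
  define \<psi> where "\<psi> = (\<lambda>z :: (real ^ 'n) \<times> real. s\<^sub>L + snd z *\<^sub>R fst z)"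
  define \<psi>' where "\<psi>' = (\<lambda>z :: (real ^ 'n) \<times> real. snd z *\<^sub>R fst_blinfun + (blinfun_scaleR_left (fst z) o\<^sub>L snd_blinfun))"
  have \<psi>: "(\<psi> has_derivative blinfun_apply (\<psi>' z)) (at z)" for z
    unfolding \<psi>_def \<psi>'_def
    by (auto intro!: derivative_eq_intros simp: blinfun.add_left blinfun.scaleR_left)
  have cont\<psi>: "continuous_on A \<psi>" for A
    unfolding \<psi>_def by (intro continuous_intros)
  have cont\<psi>': "continuous_on A \<psi>'" for A
    unfolding \<psi>'_def
    by (intro continuous_intros bounded_linear.continuous_on[OF bounded_linear_blinfun_scaleR_left])
  define S2 where "S2 = \<psi> -` U1 \<inter> (UNIV \<times> {0<..})"
  have "open S2"
    unfolding S2_def by (intro open_Int open_vimage U1 open_Times cont\<psi>) auto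
  have S2U: "\<psi> z \<in> U" if "z \<in> S2" for z
    using that U1 unfolding S2_def by blast
  define G where "G = (\<lambda>z. H (g (\<psi> z)) (\<psi> z))"
  define G' where "G' = (\<lambda>z. \<phi>' (\<psi> z) o\<^sub>L \<psi>' z)"
  have derG: "(G has_derivative blinfun_apply (G' z)) (at z)" if "z \<in> S2" for z
  proof -
    have "(G has_derivative (\<lambda>h. \<phi>' (\<psi> z) (\<psi>' z h))) (at z)"
      unfolding G_def by (rule has_derivative_compose[OF \<psi> \<phi>[OF S2U[OF that]]])
    moreover have "blinfun_apply (G' z) = (\<lambda>h. \<phi>' (\<psi> z) (\<psi>' z h))"
      by (simp add: G'_def fun_eq_iff)
    ultimately show ?thesis by simp
  qed
  have contG': "continuous_on S2 G'"
    unfolding G'_def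
    by (intro continuous_intros cont\<psi>' continuous_on_compose2[OF cont\<phi>' cont\<psi>]) (use S2U in blast)
  have \<psi>0: "\<psi> (a0, R) = s0" by (simp add: \<psi>_def s0_def)
  have zR1: "(a0, R) \<in> S2" using U1 R \<psi>0 by (simp add: S2_def)
  have zR2: "G (a0, R) = 0" using t0 g0 by (simp add: G_def \<psi>0 crit_def)
  \<comment> \<open>Varying the radius moves the entropy in direction \<open>a0\<close>, along which
    \<open>H\<close> increases strictly.\<close>
  have "G' (a0, R) (0, 1) = H' (s0, t0) (a0, 0)"
    by (simp add: G'_def \<psi>0 \<phi>'_def g0 \<psi>'_def blinfun.add_left blinfun.scaleR_left)
  then have zR3: "G' (a0, R) (0, 1) \<noteq> 0"
    using H'_s_pos[of t0 a0 s0] t0 a0 by (simp add: crit_def)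
  obtain V l l' where V: "open V" "a0 \<in> V"
    and l': "\<And>a. a \<in> V \<Longrightarrow> (l has_derivative blinfun_apply (l' a)) (at a)" "continuous_on V l'"
    and l: "\<And>a. a \<in> V \<Longrightarrow> (a, l a) \<in> S2" "\<And>a. a \<in> V \<Longrightarrow> G (a, l a) = 0"
    by (rule implicit_function_real[OF \<open>open S2\<close> derG contG' zR1 zR2 zR3], assumption, (rule that; (assumption | simp)))
  \<comment> \<open>\<open>U1\<close> and \<open>S2\<close> supply the negative slope and the
    positive radius, so uniqueness of the critical radius applies. Thus \<open>l\<close> is the
    local C1 extension demanded by \<open>C1_on\<close>.\<close>
  have "l a = radius a" if "a \<in> pos_sphere \<inter> V" for a
  proof -
    have s: "s\<^sub>L + l a *\<^sub>R a \<in> U1" "0 < l a" "H (g (s\<^sub>L + l a *\<^sub>R a)) (s\<^sub>L + l a *\<^sub>R a) = 0"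
      using l[of a] that by (auto simp: S2_def G_def \<psi>_def)
    then have "crit (s\<^sub>L + l a *\<^sub>R a) (g (s\<^sub>L + l a *\<^sub>R a))"
      using g unfolding crit_def U1_def S_def by auto
    then show ?thesis using radius_eqI s that by auto
  qed
  then show "\<exists>U g. open U \<and> a0 \<in> U \<and> Ck_on 1 U g \<and> (\<forall>y\<in>pos_sphere \<inter> U. g y = radius y)"
    using V Ck_on_1I[OF l'] by blast
qed

section \<open>The closed region and the root map\<close>

text \<open>The closure of \<open>K_set\<close> in ray coordinates; the two inclusions are
  \<open>closure_K_subset_star\<close> and \<open>segment_subset_closure_K\<close>.\<close>

definition star :: "(real ^ 'n) set"
  where "star = {s\<^sub>L + r *\<^sub>R a | r a. a \<in> pos_sphere \<and> 0 \<le> r \<and> r \<le> radius a}"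

text \<open>Rescaling each segment by the continuous function \<open>radius\<close> presents the set
  as a continuous image of the compact product of \<open>pos_sphere\<close> and [0, 1].\<close>

lemma compact_star: "compact star"
proof -
  have "closed {a :: real ^ 'n. \<forall>i. 0 \<le> a $ i}"
    by (intro closed_Collect_all closed_Collect_le continuous_intros)
  moreover have *: "pos_sphere = sphere 0 1 \<inter> {a :: real ^ 'n. \<forall>i. 0 \<le> a $ i}"
    by (auto simp: pos_sphere_def)
  ultimately have "compact (pos_sphere :: (real ^ 'n) set)"
    unfolding * by (intro compact_Int_closed compact_sphere)
  then have "compact ((\<lambda>(a, u). s\<^sub>L + (u * radius a) *\<^sub>R a) ` (pos_sphere \<times> {0..1}))"
    unfolding case_prod_beta
    by (intro compact_continuous_image compact_Times continuous_intros
        continuous_on_compose2[OF C1_on_imp_continuous_on[OF C1_radius]]) auto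
  moreover have "star = (\<lambda>(a, u). s\<^sub>L + (u * radius a) *\<^sub>R a) ` (pos_sphere \<times> {0..1})"
  proof (intro set_eqI iffI)
    fix s assume "s \<in> star"
    then obtain r a where *: "s = s\<^sub>L + r *\<^sub>R a" "a \<in> pos_sphere" "0 \<le> r" "r \<le> radius a"
      by (auto simp: star_def)
    then show "s \<in> (\<lambda>(a, u). s\<^sub>L + (u * radius a) *\<^sub>R a) ` (pos_sphere \<times> {0..1})"
      using radius(1)[of a] by (intro image_eqI[of _ _ "(a, r / radius a)"]) auto
  next
    fix s assume "s \<in> (\<lambda>(a, u). s\<^sub>L + (u * radius a) *\<^sub>R a) ` (pos_sphere \<times> {0..1})"
    then obtain u a where *: "s = s\<^sub>L + (u * radius a) *\<^sub>R a" "a \<in> pos_sphere" "0 \<le> u" "u \<le> 1"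
      by auto
    then have "0 \<le> u * radius a" "u * radius a \<le> radius a"
      using radius(1)[of a] by (auto simp: mult_le_cancel_right1)
    then show "s \<in> star" using * by (auto simp: star_def)
  qed
  ultimately show ?thesis by simp
qed

lemma K_setE:
  assumes "s \<in> K_set s\<^sub>L radius"
  obtains r a where "s = s\<^sub>L + r *\<^sub>R a" "a \<in> pos_sphere" "0 < r" "r < radius a"
  using assms unfolding K_set_def by blast

lemma K_setI: "a \<in> pos_sphere \<Longrightarrow> 0 < r \<Longrightarrow> r < radius a \<Longrightarrow> s\<^sub>L + r *\<^sub>R a \<in> K_set s\<^sub>L radius"
  unfolding K_set_def S_plus_def using less_imp_le by blast

lemma C_setI: "a \<in> pos_sphere \<Longrightarrow> s\<^sub>L + radius a *\<^sub>R a \<in> C_set s\<^sub>L radius"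
  unfolding C_set_def S_plus_def using less_imp_le[OF radius(1)] by blast

lemma K_subset_star: "K_set s\<^sub>L radius \<subseteq> star"
  unfolding star_def using less_imp_le by (blast elim: K_setE)

lemma closure_K_subset_star: "closure (K_set s\<^sub>L radius) \<subseteq> star"
  by (intro closure_minimal K_subset_star compact_imp_closed compact_star)

text \<open>The open segment lies in \<open>K_set\<close>, and by continuity the closure of the
  parameter interval is mapped into the closure.\<close>

lemma segment_subset_closure_K:
  assumes "a \<in> pos_sphere" "u \<in> {0..radius a}"
  shows "s\<^sub>L + u *\<^sub>R a \<in> closure (K_set s\<^sub>L radius)"
proof -
  have "(\<lambda>u. s\<^sub>L + u *\<^sub>R a) ` closure {0<..<radius a} \<subseteq> closure (K_set s\<^sub>L radius)"
    using K_setI[OF assms(1)] closure_subset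
    by (intro image_closure_subset continuous_intros) fastforce+
  then show ?thesis using assms(2) radius(1)[OF assms(1)] by (simp add: image_subset_iff)
qed

text \<open>Inside the critical radius both functions are negative at the critical volume
  \<open>t0\<close>, while both are positive at \<open>\<tau>\<^sub>L\<close>. So \<open>F\<close>
  has a zero \<open>t2\<close> in between; \<open>H\<close> is positive there and therefore vanishes
  between \<open>t0\<close> and \<open>t2\<close>, where \<open>F\<close> is negative.\<close>

lemma ex_root_neg:
  assumes "s \<in> K_set s\<^sub>L radius"
  shows "\<exists>t>0. F t s < 0 \<and> H t s = 0"
proof -
  obtain r a where s: "s = s\<^sub>L + r *\<^sub>R a" "a \<in> pos_sphere" "0 < r" "r < radius a"
    using assms by (rule K_setE)
  obtain t0 where t0: "crit (s\<^sub>L + radius a *\<^sub>R a) t0" using radius s by blast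
  have t0s: "0 < t0" "F t0 s < 0" "H t0 s < 0"
    using crit_below[OF t0] t0 s by (auto simp: crit_def)
  have L: "0 < F \<tau>\<^sub>L s" "0 < H \<tau>\<^sub>L s"
    using F_ray_mono[OF tau_L_pos s(2,3), of s\<^sub>L] H_ray_mono[OF tau_L_pos s(2,3), of s\<^sub>L] F_L H_L
    by (simp_all add: s(1))
  have "t0 < \<tau>\<^sub>L"
  proof -
    have "t0 \<le> \<tau>\<^sub>L"
      using F_neg_bounds t0s(1,2) s less_imp_le by metis
    moreover have "t0 \<noteq> \<tau>\<^sub>L" using t0s L by auto
    ultimately show ?thesis by simp
  qed
  moreover have "continuous_on {t0..\<tau>\<^sub>L} (\<lambda>t. F t s)"
    using t0s by (intro continuous_intros) auto
  ultimately obtain t2 where t2: "t0 \<le> t2" "t2 \<le> \<tau>\<^sub>L" "F t2 s = 0"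
    using IVT'[of "\<lambda>t. F t s" t0 0 \<tau>\<^sub>L] t0s L by auto
  then have t2': "t0 < t2" "t2 < \<tau>\<^sub>L" using t0s L by (auto simp: less_le)
  \<comment> \<open>Between \<open>t2\<close> and \<open>\<tau>\<^sub>L\<close>, \<open>F\<close> is
    positive: a further point with \<open>F\<close> \<le> 0 would make \<open>F\<close> negative at
    \<open>t2\<close> by convexity.\<close>
  have "H \<tau>\<^sub>L s < H t2 s"
    using F_convex_neg[of t0 t2 _ s] t0s t2 t2'
    by (intro H_decreasing) (auto simp: not_less[symmetric])
  moreover have "continuous_on {t0..t2} (\<lambda>t. H t s)"
    using t0s by (intro continuous_intros) auto
  ultimately obtain t where t: "t0 \<le> t" "t \<le> t2" "H t s = 0"
    using IVT'[of "\<lambda>t. H t s" t0 0 t2] t0s L t2' by auto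
  then have "t0 < t" "t < t2" using t0s L \<open>H \<tau>\<^sub>L s < H t2 s\<close> by (auto simp: less_le)
  then have "F t s < 0" using F_convex_neg[of t0 t t2 s] t0s t2 by auto
  then show ?thesis using t \<open>t0 < t\<close> t0s by (intro exI[of _ t]) auto
qed

text \<open>The weak inequality for \<open>F\<close> lets one formula cover
  \<open>s\<^sub>L\<close>, the region and its outer boundary.\<close>

definition root :: "real ^ 'n \<Rightarrow> real"
  where "root s = (THE t. 0 < t \<and> F t s \<le> 0 \<and> H t s = 0)"

lemma root_eqI: "0 < t \<Longrightarrow> F t s \<le> 0 \<Longrightarrow> H t s = 0 \<Longrightarrow> root s = t"
  unfolding root_def using root_unique by (intro the_equality) blast+

lemma root_K:
  assumes "s \<in> K_set s\<^sub>L radius"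
  shows "0 < root s" "F (root s) s < 0" "H (root s) s = 0"
  using ex_root_neg[OF assms] root_eqI by (metis less_imp_le)+

lemma root_L: "root s\<^sub>L = \<tau>\<^sub>L"
  using root_eqI F_L H_L tau_L_pos by simp

lemma root_star:
  assumes "s \<in> star"
  shows "0 < root s" "F (root s) s \<le> 0" "H (root s) s = 0"
proof -
  obtain r a where s: "s = s\<^sub>L + r *\<^sub>R a" "a \<in> pos_sphere" "0 \<le> r" "r \<le> radius a"
    using assms by (auto simp: star_def)
  then consider "s = s\<^sub>L" | "s \<in> K_set s\<^sub>L radius" | "r = radius a"
    using K_setI by fastforce
  then have "0 < root s \<and> F (root s) s \<le> 0 \<and> H (root s) s = 0"
  proof cases
    case 1
    then show ?thesis using root_L F_L H_L tau_L_pos by simp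
  next
    case 2
    then show ?thesis using root_K by (simp add: less_imp_le)
  next
    case 3
    then obtain t where "crit s t" using radius s by blast
    then show ?thesis using root_eqI[of t s] by (auto simp: crit_def)
  qed
  then show "0 < root s" "F (root s) s \<le> 0" "H (root s) s = 0" by auto
qed

lemma root_C:
  assumes "s \<in> C_set s\<^sub>L radius"
  shows "F (root s) s = 0"
proof -
  obtain a where s: "s = s\<^sub>L + radius a *\<^sub>R a" "a \<in> pos_sphere"
    using assms unfolding C_set_def by blast
  then obtain t where t: "crit s t" using radius by blast
  then have "root s = t" using root_eqI by (simp add: crit_def)
  then show ?thesis using t by (simp add: crit_def)
qed

text \<open>The graph of \<open>root\<close> over \<open>star\<close> is the compact set \<Gamma>,
  cut out by \<open>F\<close> \<le> 0 and \<open>H = 0\<close> in a box. The projection to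
  \<open>s\<close> is continuous and injective on it, hence has a continuous inverse. This also
  covers boundary points with \<open>F = 0\<close>, where the slope of \<open>H\<close> in the
  volume vanishes and the implicit function theorem fails to apply.\<close>

lemma continuous_on_root: "continuous_on star root"
proof -
  obtain \<delta> where \<delta>: "0 < \<delta>"
    "\<And>t r a. 0 < t \<Longrightarrow> 0 \<le> r \<Longrightarrow> a \<in> pos_sphere \<Longrightarrow> F t (s\<^sub>L + r *\<^sub>R a) \<le> 0 \<Longrightarrow> \<delta> \<le> t \<and> t \<le> \<tau>\<^sub>L"
    using F_neg_bounds by metis
  define Q where "Q = star \<times> {\<delta>..\<tau>\<^sub>L}"
  have Q: "compact Q" unfolding Q_def by (intro compact_Times compact_star compact_Icc)
  have contF: "continuous_on Q (\<lambda>z. F (snd z) (fst z))" and contH: "continuous_on Q (\<lambda>z. H (snd z) (fst z))"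
    unfolding Q_def using \<delta>(1) by (intro continuous_intros; auto)+
  define \<Gamma> where "\<Gamma> = Q \<inter> ({z \<in> Q. F (snd z) (fst z) \<le> 0} \<inter> {z \<in> Q. H (snd z) (fst z) = 0})"
  have "compact \<Gamma>"
    unfolding \<Gamma>_def
    by (intro compact_Int_closed Q closed_Int continuous_on_closed_Collect_le continuous_closed_preimage_constant
        contF contH continuous_on_const compact_imp_closed)
  have "root s \<in> {\<delta>..\<tau>\<^sub>L}" if "s \<in> star" for s
    using root_star[OF that] that \<delta>(2) unfolding star_def by fastforce
  then have img: "star = fst ` \<Gamma>"
    using root_star by (force simp: \<Gamma>_def Q_def intro!: image_eqI[of _ fst "(_, root _)"])
  have "continuous_on (fst ` \<Gamma>) (\<lambda>s. (s, root s))"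
  proof (rule continuous_on_inv[OF _ \<open>compact \<Gamma>\<close>])
    show "\<forall>z\<in>\<Gamma>. (fst z, root (fst z)) = z"
    proof
      fix z assume "z \<in> \<Gamma>"
      then have "root (fst z) = snd z"
        using \<delta>(1) unfolding \<Gamma>_def Q_def by (intro root_eqI) auto
      then show "(fst z, root (fst z)) = z" by (simp add: prod_eq_iff)
    qed
  qed (intro continuous_intros)
  then show ?thesis
    using continuous_on_snd unfolding img by fastforce
qed

lemma C1_root: "C1_on (K_set s\<^sub>L radius) root"
  unfolding C1_on_def
proof
  fix s0 assume s0: "s0 \<in> K_set s\<^sub>L radius"
  define P where "P = (UNIV :: (real ^ 'n) set) \<times> {0::real<..}"
  have "open P" unfolding P_def by (intro open_Times) auto
  \<comment> \<open>Working in the open set {F < 0} makes the slope \<open>- F\<close> of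
    \<open>H\<close> nonzero at the base point, and identifies every solution found with
    \<open>root\<close>.\<close>
  define S where "S = P \<inter> (\<lambda>z. F (snd z) (fst z)) -` {..<0}"
  have "open S"
    unfolding S_def by (intro continuous_open_preimage \<open>open P\<close>) (use cont_F in \<open>auto simp: P_def\<close>)
  have derS: "((\<lambda>z. H (snd z) (fst z)) has_derivative blinfun_apply (H' z)) (at z)" if "z \<in> S" for z
    using that H_deriv[of "snd z" "fst z"] by (auto simp: S_def P_def)
  have contS: "continuous_on S H'"
    by (rule continuous_on_subset[OF cont_H']) (auto simp: S_def P_def)
  have z0: "(s0, root s0) \<in> S" "H (snd (s0, root s0)) (fst (s0, root s0)) = 0"
    using root_K[OF s0] by (auto simp: S_def P_def)
  have z1: "H' (s0, root s0) (0, 1) \<noteq> 0"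
    using root_K[OF s0] H'_tau[of "root s0" s0] by simp
  obtain U g g' where U: "open U" "s0 \<in> U"
    and g': "\<And>s. s \<in> U \<Longrightarrow> (g has_derivative blinfun_apply (g' s)) (at s)" "continuous_on U g'"
    and g: "\<And>s. s \<in> U \<Longrightarrow> (s, g s) \<in> S" "\<And>s. s \<in> U \<Longrightarrow> H (snd (s, g s)) (fst (s, g s)) = 0"
    by (rule implicit_function_real[OF \<open>open S\<close> derS contS z0 z1], assumption, (rule that; (assumption | simp)))
  have "g s = root s" if "s \<in> U" for s
    using g[OF that] root_eqI[of "g s" s] by (auto simp: S_def P_def)
  then show "\<exists>U g. open U \<and> s0 \<in> U \<and> Ck_on 1 U g \<and> (\<forall>y\<in>K_set s\<^sub>L radius \<inter> U. g y = root y)"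
    using U Ck_on_1I[OF g'] by blast
qed

text \<open>On \<open>K\<close> the equation \<open>H = 0\<close> also has solutions with \<open>F > 0\<close>, one on either side of the set
  \<open>F < 0\<close>. A competitor following one of these along a ray would have \<open>F_\<tau> > 0\<close> at \<open>s\<^sub>L\<close> and
  \<open>F_\<tau> < 0\<close> at the far end, hence would meet the minimum of \<open>F\<close>, where \<open>F < 0\<close>.\<close>

lemma root_unique_global:
  assumes cont: "continuous_on (closure (K_set s\<^sub>L radius)) T"
    and pos: "\<And>s. s \<in> closure (K_set s\<^sub>L radius) \<Longrightarrow> 0 < T s"
    and H0: "\<And>s. s \<in> closure (K_set s\<^sub>L radius) \<Longrightarrow> H (T s) s = 0"
    and F_C: "\<And>s. s \<in> C_set s\<^sub>L radius \<Longrightarrow> F (T s) s = 0"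
    and F_L0: "F (T s\<^sub>L) s\<^sub>L = 0"
    and s: "s \<in> closure (K_set s\<^sub>L radius)"
  shows "T s = root s"
proof -
  have "s \<in> star" using s closure_K_subset_star by blast
  then obtain r a where r: "s = s\<^sub>L + r *\<^sub>R a" "a \<in> pos_sphere" "0 \<le> r" "r \<le> radius a"
    by (auto simp: star_def)
  define R where "R = radius a"
  define \<gamma> where "\<gamma> = (\<lambda>u. s\<^sub>L + u *\<^sub>R a)"
  define f where "f = (\<lambda>u. T (\<gamma> u))"
  have \<gamma>: "\<gamma> u \<in> closure (K_set s\<^sub>L radius)" if "u \<in> {0..R}" for u
    using segment_subset_closure_K[OF r(2), of u] that by (simp add: \<gamma>_def R_def)
  have cont\<gamma>: "continuous_on A \<gamma>" for A unfolding \<gamma>_def by (intro continuous_intros)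
  have contf: "continuous_on {0..R} f"
    unfolding f_def by (rule continuous_on_compose2[OF cont cont\<gamma>]) (use \<gamma> in blast)
  have f: "0 < f u" "H (f u) (\<gamma> u) = 0" if "u \<in> {0..R}" for u
    using pos H0 \<gamma>[OF that] by (auto simp: f_def)
  have R: "0 < R" using radius r by (simp add: R_def)
  have K: "\<gamma> u \<in> K_set s\<^sub>L radius" if "0 < u" "u < R" for u
    using K_setI[OF r(2)] that by (simp add: \<gamma>_def R_def)
  have contFf: "continuous_on {0..R} (\<lambda>u. F (f u) (\<gamma> u))"
    by (intro continuous_intros contf cont\<gamma> f)
  have contF'f: "continuous_on {0..R} (\<lambda>u. F' (\<gamma> u, f u) (0, 1))"
    by (intro continuous_intros continuous_on_compose2[OF cont_F' continuous_on_Pair[OF cont\<gamma> contf]])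
      (use f in auto)
  \<comment> \<open>At both ends of the ray the prescribed \<open>F = 0\<close> makes the competitor
    equal to \<open>root\<close>, which fixes the sign of the slope there.\<close>
  have F0: "F (f 0) (\<gamma> 0) = 0" "f 0 = \<tau>\<^sub>L"
  proof -
    show "F (f 0) (\<gamma> 0) = 0" using F_L0 by (simp add: f_def \<gamma>_def)
    then show "f 0 = \<tau>\<^sub>L"
      using root_eqI[of "f 0" "\<gamma> 0"] f[of 0] R root_L by (simp add: \<gamma>_def)
  qed
  have FR: "F (f R) (\<gamma> R) = 0" "F' (\<gamma> R, f R) (0, 1) < 0"
  proof -
    show "F (f R) (\<gamma> R) = 0" using F_C C_setI r by (simp add: f_def \<gamma>_def R_def)
    then have "root (\<gamma> R) = f R" using root_eqI f[of R] R by simp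
    moreover obtain t where t: "crit (\<gamma> R) t" using radius r by (auto simp: \<gamma>_def R_def)
    then have "root (\<gamma> R) = t" using root_eqI by (simp add: crit_def)
    ultimately show "F' (\<gamma> R, f R) (0, 1) < 0" using t by (simp add: crit_def)
  qed
  \<comment> \<open>A zero of \<open>F\<close> would make the competitor equal to
    \<open>root\<close>, but \<open>root\<close> has \<open>F\<close> < 0 on the region.\<close>
  have F_ne: "F (f u) (\<gamma> u) \<noteq> 0" if "0 < u" "u < R" for u
  proof
    assume "F (f u) (\<gamma> u) = 0"
    then have "root (\<gamma> u) = f u" using root_eqI f[of u] that by simp
    then show False using root_K(2)[OF K[OF that]] \<open>F (f u) (\<gamma> u) = 0\<close> by simp
  qed
  have F_neg: "F (f u) (\<gamma> u) < 0" if u: "0 < u" "u < R" for u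
  proof (rule ccontr)
    assume "\<not> ?thesis"
    then have Fu: "0 < F (f u) (\<gamma> u)" using F_ne[OF u] by linarith
    obtain v where v: "0 \<le> v" "v \<le> R" "F' (\<gamma> v, f v) (0, 1) = 0"
      using IVT2'[of "\<lambda>u. F' (\<gamma> u, f u) (0, 1)" R 0 0] contF'f FR F0 F'_L R by (auto simp: \<gamma>_def)
    moreover have "v \<noteq> 0" "v \<noteq> R" using v FR F0 F'_L by (auto simp: \<gamma>_def)
    ultimately have v': "0 < v" "v < R" by auto
    \<comment> \<open>Along the open segment \<open>F\<close> never vanishes, so it has the same
      sign at \<open>v\<close> as at \<open>u\<close>.\<close>
    have conn: "connected ((\<lambda>u. F (f u) (\<gamma> u)) ` {0<..<R})"
      by (intro connected_continuous_image continuous_on_subset[OF contFf]) auto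
    have ne: "0 \<notin> (\<lambda>u. F (f u) (\<gamma> u)) ` {0<..<R}" using F_ne by (auto simp: image_iff)
    have Fv: "0 \<le> F (f v) (\<gamma> v)"
    proof (rule ccontr)
      assume "\<not> ?thesis"
      moreover have "F (f v) (\<gamma> v) \<in> (\<lambda>u. F (f u) (\<gamma> u)) ` {0<..<R}"
          "F (f u) (\<gamma> u) \<in> (\<lambda>u. F (f u) (\<gamma> u)) ` {0<..<R}"
        using u v' by auto
      ultimately show False
        using connectedD_interval[OF conn, of "F (f v) (\<gamma> v)" "F (f u) (\<gamma> u)" 0] Fu ne by simp
    qed
    \<comment> \<open>\<open>f v\<close> minimises the convex function \<open>F\<close> at fixed
      entropy \<open>\<gamma> v\<close> with a nonnegative value, which is incompatible with the
      negative value at the root.\<close>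
    define x where "x = root (\<gamma> v)"
    have x: "0 < x" "F x (\<gamma> v) < 0" using root_K[OF K[OF v']] by (simp_all add: x_def)
    have "0 < f v" using f[of v] v by simp
    then show False
      using F_pos_left[of x "f v" "\<gamma> v"] F_pos_right[of "f v" x "\<gamma> v"] v(3) Fv x
      by (cases x "f v" rule: linorder_cases) auto
  qed
  have "F (f r) (\<gamma> r) \<le> 0"
    using F_neg[of r] r F0 FR by (cases "r = 0"; cases "r = R") (auto simp: R_def)
  then show ?thesis
    using root_eqI[of "f r" "\<gamma> r"] f[of r] r by (simp add: f_def \<gamma>_def R_def)
qed

text \<open>In the uniqueness clause, the condition at \<open>s\<^sub>L\<close> fixes the branch at
  the start of each ray and the condition on \<open>C\<close> fixes it at the end.\<close>

theorem root_extension: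
  "C1_on pos_sphere radius \<and> (\<forall>a\<in>pos_sphere. 0 < radius a) \<and>
    (let K = K_set s\<^sub>L radius; C = C_set s\<^sub>L radius in
      \<exists>T. C0_C1_pos K T \<and>
        (\<forall>s\<in>closure K. H (T s) s = 0) \<and>
        (\<forall>s\<in>C. F (T s) s = 0) \<and>
        F (T s\<^sub>L) s\<^sub>L = 0 \<and>
        (\<forall>s\<in>K. F (T s) s < 0) \<and>
        (\<forall>T'. C0_C1_pos K T' \<and>
            (\<forall>s\<in>closure K. H (T' s) s = 0) \<and>
            (\<forall>s\<in>C. F (T' s) s = 0) \<and>
            F (T' s\<^sub>L) s\<^sub>L = 0
          \<longrightarrow> (\<forall>s\<in>closure K. T' s = T s)))"
proof -
  have "C0_C1_pos (K_set s\<^sub>L radius) root"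
    unfolding C0_C1_pos_def
    using continuous_on_subset[OF continuous_on_root closure_K_subset_star] C1_root
      root_star(1) closure_K_subset_star by blast
  moreover have "\<forall>s\<in>closure (K_set s\<^sub>L radius). H (root s) s = 0"
    using root_star(3) closure_K_subset_star by blast
  ultimately show ?thesis
    unfolding Let_def
    using C1_radius radius(1) root_C root_K(2) root_L F_L root_unique_global
    by (intro conjI exI[of _ root]) (auto simp: C0_C1_pos_def)
qed

end

section \<open>Energies and pressures\<close>

lemma pos_sphere_ex_pos:
  assumes "a \<in> pos_sphere"
  obtains i where "0 < a $ i"
proof -
  have "a \<noteq> 0" using assms by (auto simp: pos_sphere_def)
  then obtain i where "a $ i \<noteq> 0" by (auto simp: vec_eq_iff)
  then have "0 < a $ i" using assms by (auto simp: pos_sphere_def less_le)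
  then show thesis by (rule that)
qed

lemma sum_pos_sphere_pos:
  fixes a :: "real ^ 'n::finite"
  assumes "a \<in> pos_sphere" "\<And>i. 0 < f i"
  shows "0 < (\<Sum>i\<in>UNIV. a $ i * f i)"
proof -
  obtain i where "0 < a $ i" using assms(1) by (rule pos_sphere_ex_pos)
  then show ?thesis
    using assms by (intro sum_pos2[of UNIV i]) (auto simp: pos_sphere_def less_imp_le)
qed

text \<open>Converts the argument order of the locale, entropy vector before volume, to that of the
  \<open>i\<close>-th energy; the chain rule through it assembles the sums over
  \<open>i\<close>.\<close>

lift_definition volume_entropy :: "'n::finite \<Rightarrow> ((real ^ 'n) \<times> real) \<Rightarrow>\<^sub>L (real \<times> real)"
  is "\<lambda>i z. (snd z, fst z $ i)"
  by (intro bounded_linear_Pair bounded_linear_snd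
      bounded_linear_compose[OF bounded_linear_vec_nth bounded_linear_fst])

declare volume_entropy.rep_eq [simp]

lemma has_derivative_sum_volume_entropy:
  fixes f :: "'n::finite \<Rightarrow> real \<times> real \<Rightarrow> real" and D :: "'n \<Rightarrow> real \<times> real \<Rightarrow> (real \<times> real) \<Rightarrow>\<^sub>L real"
  assumes "\<And>i z. z \<in> {0<..} \<times> UNIV \<Longrightarrow> (f i has_derivative blinfun_apply (D i z)) (at z)" "0 < t"
  shows "((\<lambda>z. \<Sum>i\<in>UNIV. f i (snd z, fst z $ i)) has_derivative
    blinfun_apply (\<Sum>i\<in>UNIV. D i (t, s $ i) o\<^sub>L volume_entropy i)) (at (s, t))"
proof -
  have "((\<lambda>z. \<Sum>i\<in>UNIV. f i (volume_entropy i z)) has_derivative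
    (\<lambda>h. \<Sum>i\<in>UNIV. D i (volume_entropy i (s, t)) (volume_entropy i h))) (at (s, t))"
    using assms(2)
    by (intro has_derivative_sum has_derivative_compose[OF bounded_linear_imp_has_derivative[OF blinfun.bounded_linear_right] assms(1)])
      simp
  moreover have "blinfun_apply (\<Sum>i\<in>UNIV. D i (t, s $ i) o\<^sub>L volume_entropy i) =
      (\<lambda>h. \<Sum>i\<in>UNIV. D i (volume_entropy i (s, t)) (volume_entropy i h))"
    by (simp add: fun_eq_iff blinfun.sum_left)
  ultimately show ?thesis by simp
qed

lemma continuous_on_sum_volume_entropy:
  fixes D :: "'n::finite \<Rightarrow> real \<times> real \<Rightarrow> (real \<times> real) \<Rightarrow>\<^sub>L real"
  assumes "\<And>i. continuous_on ({0<..} \<times> UNIV) (D i)"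
  shows "continuous_on (UNIV \<times> {0<..}) (\<lambda>z. \<Sum>i\<in>UNIV. D i (snd z, fst z $ i) o\<^sub>L volume_entropy i)"
  by (intro continuous_intros continuous_on_compose2[OF assms]) auto

section \<open>Regularity of the energies and pressures\<close>

context
  fixes e :: "'n::finite \<Rightarrow> real \<Rightarrow> real \<Rightarrow> real"
  assumes smooth: "\<And>i. smooth_on ({0<..} \<times> UNIV) (\<lambda>(\<tau>, \<sigma>). e i \<tau> \<sigma>)"
begin

lemma open_half_plane: "open ({0<..} \<times> UNIV :: (real \<times> real) set)"
  by (intro open_Times) auto

lemma DERIV_energy_i:
  assumes "z \<in> {0<..} \<times> UNIV"
  shows "(case_prod (e i) has_derivative blinfun_apply (total_derivative (case_prod (e i)) z)) (at z)"
  using has_derivative_total_derivative[OF smooth_on_imp_differentiable[OF smooth assms]] by simp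

lemma DERIV_energy_i_volume:
  assumes "0 < \<tau>"
  shows "((\<lambda>t. e i t \<sigma>) has_real_derivative - pressure_i e i \<tau> \<sigma>) (at \<tau>)"
    and "pressure_i e i \<tau> \<sigma> = - total_derivative (case_prod (e i)) (\<tau>, \<sigma>) (1, 0)"
proof -
  have "((\<lambda>t. e i t \<sigma>) has_real_derivative total_derivative (case_prod (e i)) (\<tau>, \<sigma>) (1, 0)) (at \<tau>)"
    using has_real_derivative_partial_fst[OF DERIV_energy_i[of "(\<tau>, \<sigma>)" i]] assms by simp
  then show "((\<lambda>t. e i t \<sigma>) has_real_derivative - pressure_i e i \<tau> \<sigma>) (at \<tau>)"
    "pressure_i e i \<tau> \<sigma> = - total_derivative (case_prod (e i)) (\<tau>, \<sigma>) (1, 0)"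
    unfolding pressure_i_def by (simp_all add: DERIV_imp_deriv)
qed

lemma temperature_i_eq:
  assumes "0 < \<tau>"
  shows "temperature_i e i \<tau> \<sigma> = total_derivative (case_prod (e i)) (\<tau>, \<sigma>) (0, 1)"
  unfolding temperature_i_def
  using has_real_derivative_partial_snd[OF DERIV_energy_i[of "(\<tau>, \<sigma>)" i]] assms
  by (intro DERIV_imp_deriv) simp

lemma smooth_pressure_i: "smooth_on ({0<..} \<times> UNIV) (case_prod (pressure_i e i))"
proof (rule smooth_on_cong[OF open_half_plane])
  show "smooth_on ({0<..} \<times> UNIV) (\<lambda>z. - frechet_derivative (case_prod (e i)) (at z) (1, 0))"
    using smooth by (intro smooth_on_uminus[OF open_half_plane] smooth_on_frechet_derivative) simp
  fix z :: "real \<times> real" assume z: "z \<in> {0<..} \<times> UNIV"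
  then have "case_prod (e i) differentiable (at z)"
    using smooth_on_imp_differentiable[OF smooth] by simp
  then show "- frechet_derivative (case_prod (e i)) (at z) (1, 0) = case_prod (pressure_i e i) z"
    using z by (auto simp: DERIV_energy_i_volume(2) blinfun_apply_total_derivative)
qed

lemma DERIV_pressure_i:
  assumes "z \<in> {0<..} \<times> UNIV"
  shows "(case_prod (pressure_i e i) has_derivative
    blinfun_apply (total_derivative (case_prod (pressure_i e i)) z)) (at z)"
  using has_derivative_total_derivative[OF smooth_on_imp_differentiable[OF smooth_pressure_i assms]] .

lemma DERIV_pressure_i_volume:
  assumes "0 < \<tau>"
  shows "((\<lambda>t. pressure_i e i t \<sigma>) has_real_derivative
    total_derivative (case_prod (pressure_i e i)) (\<tau>, \<sigma>) (1, 0)) (at \<tau>)"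
  using has_real_derivative_partial_fst[OF DERIV_pressure_i[of "(\<tau>, \<sigma>)" i]] assms by simp

lemma deriv_pressure_i_entropy:
  assumes "0 < \<tau>"
  shows "deriv (\<lambda>s. pressure_i e i \<tau> s) \<sigma> = total_derivative (case_prod (pressure_i e i)) (\<tau>, \<sigma>) (0, 1)"
  using has_real_derivative_partial_snd[OF DERIV_pressure_i[of "(\<tau>, \<sigma>)" i]] assms
  by (intro DERIV_imp_deriv) simp

lemma deriv_pressure:
  assumes "0 < \<tau>"
  shows "deriv (\<lambda>t. pressure e t s) \<tau> = (\<Sum>i\<in>UNIV. total_derivative (case_prod (pressure_i e i)) (\<tau>, s $ i) (1, 0))"
  unfolding pressure_def
  by (intro DERIV_imp_deriv DERIV_sum DERIV_pressure_i_volume assms)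

text \<open>\<open>deriv\<close> has an arbitrary value where no derivative exists; this lemma is
  what turns the sign of the iterated \<open>deriv\<close> into strict growth of the pressure
  slope.\<close>

lemma deriv_pressure_differentiable:
  assumes "0 < \<tau>"
  shows "(deriv (\<lambda>t. pressure e t s)) differentiable (at \<tau>)"
proof -
  let ?P = "\<lambda>i. case_prod (pressure_i e i)"
  have eq: "deriv (\<lambda>t. pressure e t s) t = (\<Sum>i\<in>UNIV. frechet_derivative (?P i) (at (t, s $ i)) (1, 0))"
    if "0 < t" for t
    using that smooth_on_imp_differentiable[OF smooth_pressure_i]
    by (simp add: deriv_pressure blinfun_apply_total_derivative)
  have "(\<lambda>t. frechet_derivative (?P i) (at (t, s $ i)) (1, 0)) differentiable (at \<tau>)" for i
  proof -
    have "(\<lambda>z. frechet_derivative (?P i) (at z) (1, 0)) differentiable (at (\<tau>, s $ i))"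
      using assms by (intro smooth_on_imp_differentiable[OF smooth_on_frechet_derivative[OF smooth_pressure_i]]) simp
    from has_real_derivative_partial_fst[OF has_derivative_total_derivative[OF this]]
    show ?thesis unfolding real_differentiable_def by blast
  qed
  then have "(\<lambda>t. \<Sum>i\<in>UNIV. frechet_derivative (?P i) (at (t, s $ i)) (1, 0)) differentiable (at \<tau>)"
    by (intro differentiable_sum) auto
  then show ?thesis
    by (rule frechet_derivative_cong_open(1)[of "{0<..}", rotated -1]) (use eq assms in auto)
qed

lemma has_derivative_energy:
  assumes "0 < t"
  shows "((\<lambda>z. energy e (snd z) (fst z)) has_derivative
    blinfun_apply (\<Sum>i\<in>UNIV. total_derivative (case_prod (e i)) (t, s $ i) o\<^sub>L volume_entropy i)) (at (s, t))"
proof -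
  have "((\<lambda>z. \<Sum>i\<in>UNIV. case_prod (e i) (snd z, fst z $ i)) has_derivative
    blinfun_apply (\<Sum>i\<in>UNIV. total_derivative (case_prod (e i)) (t, s $ i) o\<^sub>L volume_entropy i)) (at (s, t))"
    by (rule has_derivative_sum_volume_entropy) (use DERIV_energy_i assms in blast)+
  then show ?thesis by (simp add: energy_def)
qed

lemma has_derivative_pressure:
  assumes "0 < t"
  shows "((\<lambda>z. pressure e (snd z) (fst z)) has_derivative
    blinfun_apply (\<Sum>i\<in>UNIV. total_derivative (case_prod (pressure_i e i)) (t, s $ i) o\<^sub>L volume_entropy i)) (at (s, t))"
proof -
  have "((\<lambda>z. \<Sum>i\<in>UNIV. case_prod (pressure_i e i) (snd z, fst z $ i)) has_derivative
    blinfun_apply (\<Sum>i\<in>UNIV. total_derivative (case_prod (pressure_i e i)) (t, s $ i) o\<^sub>L volume_entropy i)) (at (s, t))"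
    by (rule has_derivative_sum_volume_entropy) (use DERIV_pressure_i assms in blast)+
  then show ?thesis by (simp add: pressure_def)
qed

end

theorem theorem5p1:
  fixes e :: "'n::finite \<Rightarrow> real \<Rightarrow> real \<Rightarrow> real"
    and \<tau>\<^sub>L m :: real and s\<^sub>L :: "real ^ 'n"
  assumes smooth: "\<And>i. smooth_on ({0<..} \<times> UNIV) (\<lambda>(\<tau>, \<sigma>). e i \<tau> \<sigma>)"
    and strictly_convex: "\<And>i. strictly_convex_on ({0<..} \<times> UNIV) (\<lambda>(\<tau>, \<sigma>). e i \<tau> \<sigma>)"
    and p_pos: "\<And>i \<tau> \<sigma>. 0 < \<tau> \<Longrightarrow> 0 < pressure_i e i \<tau> \<sigma>"
    and T_pos: "\<And>i \<tau> \<sigma>. 0 < \<tau> \<Longrightarrow> 0 < temperature_i e i \<tau> \<sigma>"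
    and e_tau_0: "\<And>i \<sigma>. filterlim (\<lambda>\<tau>. e i \<tau> \<sigma>) at_top (at_right 0)"
    and e_s_top: "\<And>i \<tau>. 0 < \<tau> \<Longrightarrow> filterlim (\<lambda>\<sigma>. e i \<tau> \<sigma>) at_top at_top"
    and e_tau_top: "\<And>i \<sigma>. ((\<lambda>\<tau>. e i \<tau> \<sigma>) \<longlongrightarrow> 0) at_top"
    and p_s_pos: "\<And>i \<tau> \<sigma>. 0 < \<tau> \<Longrightarrow> 0 < deriv (\<lambda>s. pressure_i e i \<tau> s) \<sigma>"
    and p_tau_s_top: "\<And>i \<tau>. 0 < \<tau> \<Longrightarrow>
          filterlim (\<lambda>\<sigma>. deriv (\<lambda>t. pressure_i e i t \<sigma>) \<tau>) at_bot at_top"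
    and p_tau_tau_pos: "\<And>\<tau> s. 0 < \<tau> \<Longrightarrow> 0 < deriv (deriv (\<lambda>t. pressure e t s)) \<tau>"
    and p_tau_0: "\<And>s. filterlim (\<lambda>\<tau>. pressure e \<tau> s) at_top (at_right 0)"
    and dp_tau_0: "\<And>s. filterlim (\<lambda>\<tau>. deriv (\<lambda>t. pressure e t s) \<tau>) at_bot (at_right 0)"
    and p_tau_top: "\<And>s. ((\<lambda>\<tau>. pressure e \<tau> s) \<longlongrightarrow> 0) at_top"
    and dp_tau_top: "\<And>s. ((\<lambda>\<tau>. deriv (\<lambda>t. pressure e t s) \<tau>) \<longlongrightarrow> 0) at_top"
    and tau_L_pos: "0 < \<tau>\<^sub>L" and m_pos: "0 < m"
    and Lax: "0 < m\<^sup>2 + deriv (\<lambda>t. pressure e t s\<^sub>L) \<tau>\<^sub>L"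
  defines "F \<equiv> F_fun e \<tau>\<^sub>L s\<^sub>L m" and "H \<equiv> H_fun e \<tau>\<^sub>L s\<^sub>L m"
  shows "\<exists>\<Lambda>\<^sub>0. C1_on pos_sphere \<Lambda>\<^sub>0 \<and> (\<forall>a\<in>pos_sphere. 0 < \<Lambda>\<^sub>0 a) \<and>
    (let K = K_set s\<^sub>L \<Lambda>\<^sub>0; C = C_set s\<^sub>L \<Lambda>\<^sub>0 in
      \<exists>T. C0_C1_pos K T \<and>
        (\<forall>s\<in>closure K. H (T s) s = 0) \<and>
        (\<forall>s\<in>C. F (T s) s = 0) \<and>
        F (T s\<^sub>L) s\<^sub>L = 0 \<and>
        (\<forall>s\<in>K. F (T s) s < 0) \<and>
        (\<forall>T'. C0_C1_pos K T' \<and>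
            (\<forall>s\<in>closure K. H (T' s) s = 0) \<and>
            (\<forall>s\<in>C. F (T' s) s = 0) \<and>
            F (T' s\<^sub>L) s\<^sub>L = 0
          \<longrightarrow> (\<forall>s\<in>closure K. T' s = T s)))"
proof -
  let ?E = "\<lambda>i. case_prod (e i)" and ?P = "\<lambda>i. case_prod (pressure_i e i)"
  let ?D = "\<lambda>f z. \<Sum>i\<in>UNIV. total_derivative (f i) (snd z, fst z $ i) o\<^sub>L volume_entropy i"
  define p\<^sub>L where "p\<^sub>L = pressure e \<tau>\<^sub>L s\<^sub>L"
  define F' where "F' = (\<lambda>z :: (real ^ 'n) \<times> real. ?D ?P z + m\<^sup>2 *\<^sub>R snd_blinfun)"
  \<comment> \<open>The coefficient of \<open>snd_blinfun\<close> is the volume derivative of the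
    quadratic and linear terms of \<open>H\<close>.\<close>
  define H' where "H' = (\<lambda>z :: (real ^ 'n) \<times> real. ?D ?E z + (m\<^sup>2 * (\<tau>\<^sub>L - snd z) + p\<^sub>L) *\<^sub>R snd_blinfun)"
  have F_eq: "F t s = (\<Sum>i\<in>UNIV. pressure_i e i t (s $ i)) - p\<^sub>L + m\<^sup>2 * (t - \<tau>\<^sub>L)" for t s
    by (simp add: F_def F_fun_def p\<^sub>L_def pressure_def)
  have H_eq: "H t s = (\<Sum>i\<in>UNIV. e i t (s $ i)) - energy e \<tau>\<^sub>L s\<^sub>L - m\<^sup>2 / 2 * (t\<^sup>2 - \<tau>\<^sub>L\<^sup>2)
      + (m\<^sup>2 * \<tau>\<^sub>L + p\<^sub>L) * (t - \<tau>\<^sub>L)" for t s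
    by (simp add: H_def H_fun_def p\<^sub>L_def energy_def)
  have p\<^sub>L_pos: "0 \<le> p\<^sub>L"
    unfolding p\<^sub>L_def pressure_def using p_pos[OF tau_L_pos] by (intro sum_nonneg) (simp add: less_imp_le)
  note DE = has_derivative_energy[OF smooth, unfolded energy_def]
    and DP = has_derivative_pressure[OF smooth, unfolded pressure_def]
  have F'_tau: "F' (s, t) (0, 1) = deriv (\<lambda>t. pressure e t s) t + m\<^sup>2" if "0 < t" for s t
    using that by (simp add: F'_def deriv_pressure[OF smooth] blinfun.add_left blinfun.sum_left blinfun.scaleR_left)
  \<comment> \<open>Once the locale assumptions are verified, \<open>root_extension\<close> is the
    claim with \<open>radius\<close> as witness.\<close>
  interpret hugoniot F H F' H' \<tau>\<^sub>L s\<^sub>L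
  proof
    fix s :: "real ^ 'n" and t :: real assume t: "0 < t"
    have "((\<lambda>z. (\<Sum>i\<in>UNIV. pressure_i e i (snd z) (fst z $ i)) - p\<^sub>L + m\<^sup>2 * (snd z - \<tau>\<^sub>L))
      has_derivative (\<lambda>h. ?D ?P (s, t) h - 0 + m\<^sup>2 * (snd h - 0))) (at (s, t))"
      using DP[OF t, where s = s]
      by (intro derivative_intros) (simp_all add: has_derivative_snd)
    moreover have "(\<lambda>h. ?D ?P (s, t) h - 0 + m\<^sup>2 * (snd h - 0)) = blinfun_apply (F' (s, t))"
      by (simp add: F'_def fun_eq_iff blinfun.add_left blinfun.scaleR_left)
    ultimately show "((\<lambda>z. F (snd z) (fst z)) has_derivative blinfun_apply (F' (s, t))) (at (s, t))"
      unfolding F_eq by simp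
    have "((\<lambda>z. (\<Sum>i\<in>UNIV. e i (snd z) (fst z $ i)) - energy e \<tau>\<^sub>L s\<^sub>L - m\<^sup>2 / 2 * ((snd z)\<^sup>2 - \<tau>\<^sub>L\<^sup>2)
          + (m\<^sup>2 * \<tau>\<^sub>L + p\<^sub>L) * (snd z - \<tau>\<^sub>L))
      has_derivative (\<lambda>h. ?D ?E (s, t) h - 0 - m\<^sup>2 / 2 * (2 * t * snd h - 0)
          + (m\<^sup>2 * \<tau>\<^sub>L + p\<^sub>L) * (snd h - 0))) (at (s, t))"
      using DE[OF t, where s = s]
      by (intro has_derivative_add has_derivative_diff has_derivative_mult_right has_derivative_const)
        (auto intro!: derivative_eq_intros)
    moreover have "(\<lambda>h. ?D ?E (s, t) h - 0 - m\<^sup>2 / 2 * (2 * t * snd h - 0) + (m\<^sup>2 * \<tau>\<^sub>L + p\<^sub>L) * (snd h - 0))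
        = blinfun_apply (H' (s, t))"
      by (simp add: H'_def fun_eq_iff blinfun.add_left blinfun.scaleR_left; simp add: algebra_simps)
    ultimately show "((\<lambda>z. H (snd z) (fst z)) has_derivative blinfun_apply (H' (s, t))) (at (s, t))"
      unfolding H_eq by simp
    show "H' (s, t) (0, 1) = - F t s"
      using t by (simp add: H'_def F_eq DERIV_energy_i_volume(2)[OF smooth] blinfun.add_left
          blinfun.sum_left blinfun.scaleR_left sum_negf; simp add: algebra_simps)
    show "F' (s, t) (0, 1) < F' (s, u) (0, 1)" if "t < u" for u
    proof -
      have "((deriv (\<lambda>t. pressure e t s)) has_real_derivative deriv (deriv (\<lambda>t. pressure e t s)) x) (at x)"
        if "t \<le> x" for x
        using deriv_pressure_differentiable[OF smooth, where s = s and \<tau> = x] t that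
        by (simp add: DERIV_deriv_iff_real_differentiable)
      then have "deriv (\<lambda>t. pressure e t s) t < deriv (\<lambda>t. pressure e t s) u"
        using t p_tau_tau_pos by (intro DERIV_pos_imp_increasing[OF that]) (meson less_le_trans)
      then show ?thesis using t that by (simp add: F'_tau)
    qed
    have scale: "L (0, r) = r * L (0, 1)" for L :: "(real \<times> real) \<Rightarrow>\<^sub>L real" and r
      using blinfun.scaleR_right[of L r "(0, 1)"] by simp
    show "0 < F' (s, t) (a, 0)" if "a \<in> pos_sphere" for a
      using sum_pos_sphere_pos[OF that, of "\<lambda>i. deriv (\<lambda>s. pressure_i e i t s) (s $ i)"] p_s_pos t
      by (simp add: F'_def blinfun.add_left blinfun.sum_left blinfun.scaleR_left
          deriv_pressure_i_entropy[OF smooth] scale[of _ "a $ _"])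
    show "0 < H' (s, t) (a, 0)" if "a \<in> pos_sphere" for a
      using sum_pos_sphere_pos[OF that, of "\<lambda>i. temperature_i e i t (s $ i)"] T_pos t
      by (simp add: H'_def blinfun.add_left blinfun.sum_left blinfun.scaleR_left
          temperature_i_eq[OF smooth] scale[of _ "a $ _"])
  next
    show "continuous_on (UNIV \<times> {0<..}) F'"
      unfolding F'_def
      by (intro continuous_on_add continuous_on_const continuous_on_sum_volume_entropy
          smooth_on_continuous_total_derivative smooth_pressure_i smooth)
    show "continuous_on (UNIV \<times> {0<..}) H'"
      unfolding H'_def using smooth
      by (intro continuous_on_add continuous_on_sum_volume_entropy
          smooth_on_continuous_total_derivative continuous_on_scaleR continuous_intros) auto
    show "0 < F' (s\<^sub>L, \<tau>\<^sub>L) (0, 1)" using Lax tau_L_pos by (simp add: F'_tau)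
    show "filterlim (\<lambda>t. F t s\<^sub>L) at_top (at_right 0)"
    proof -
      have "((\<lambda>t. - p\<^sub>L + m\<^sup>2 * (t - \<tau>\<^sub>L)) \<longlongrightarrow> - p\<^sub>L + m\<^sup>2 * (0 - \<tau>\<^sub>L)) (at_right 0)"
        by (intro tendsto_intros)
      from filterlim_tendsto_add_at_top[OF this p_tau_0]
      show ?thesis by (simp add: F_eq pressure_def algebra_simps)
    qed
    show "\<exists>r>0. \<forall>t\<in>{0<..\<tau>\<^sub>L}. 0 < H t (s\<^sub>L + r *\<^sub>R a)" if a: "a \<in> pos_sphere" for a
    proof -
      obtain i where i: "0 < a $ i" using a by (rule pos_sphere_ex_pos)
      \<comment> \<open>On volumes in (0, \<open>\<tau>\<^sub>L\<close>], the terms of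
        \<open>H\<close> other than the energy are at least \<open>- B\<close>: the quadratic term
        contributes nonnegatively and the linear one is bounded below by its value at volume
        0.\<close>
      define B where "B = energy e \<tau>\<^sub>L s\<^sub>L + (m\<^sup>2 * \<tau>\<^sub>L + p\<^sub>L) * \<tau>\<^sub>L"
      have "eventually (\<lambda>\<sigma>. B < e i \<tau>\<^sub>L \<sigma> \<and> s\<^sub>L $ i < \<sigma>) at_top"
        using e_s_top[OF tau_L_pos, of i] eventually_gt_at_top[of "s\<^sub>L $ i"]
        by (auto simp: filterlim_at_top_dense intro: eventually_conj)
      then obtain \<sigma> where \<sigma>: "B < e i \<tau>\<^sub>L \<sigma>" "s\<^sub>L $ i < \<sigma>"
        using eventually_happens trivial_limit_at_top_linorder by blast
      \<comment> \<open>This radius brings the entropy coordinate \<open>i\<close> exactly to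
        \<sigma>. The single energy \<open>e i\<close> then exceeds \<open>B\<close> at
        \<open>\<tau>\<^sub>L\<close>, hence at all smaller volumes since it decreases in the
        volume.\<close>
      define r where "r = (\<sigma> - s\<^sub>L $ i) / a $ i"
      have r: "0 < r" "(s\<^sub>L + r *\<^sub>R a) $ i = \<sigma>" using i \<sigma> by (simp_all add: r_def)
      have anti: "e j u \<xi> \<le> e j t \<xi>" if "0 < t" "t \<le> u" for j t u \<xi>
      proof (rule DERIV_nonpos_imp_nonincreasing[OF that(2)])
        fix x assume "t \<le> x"
        then have "0 < x" using that by simp
        then show "\<exists>y. ((\<lambda>t. e j t \<xi>) has_real_derivative y) (at x) \<and> y \<le> 0"
          using DERIV_energy_i_volume(1)[where e = e and i = j and \<sigma> = \<xi>, OF smooth] p_pos[of x j \<xi>]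
          by (intro exI[of _ "- pressure_i e j x \<xi>"]) simp
      qed
      \<comment> \<open>Each energy decreases in the volume to its limit 0, so one summand bounds
        the total energy from below.\<close>
      have nonneg: "0 \<le> e j t \<xi>" if "0 < t" for j t \<xi>
        by (rule tendsto_upperbound[OF e_tau_top[of j \<xi>] eventually_mono[OF eventually_ge_at_top[of t]]])
          (use anti that in auto)
      have "0 < H t (s\<^sub>L + r *\<^sub>R a)" if t: "t \<in> {0<..\<tau>\<^sub>L}" for t
      proof -
        have "e i t \<sigma> \<le> (\<Sum>j\<in>UNIV. e j t ((s\<^sub>L + r *\<^sub>R a) $ j))"
          using member_le_sum[of i UNIV "\<lambda>j. e j t ((s\<^sub>L + r *\<^sub>R a) $ j)"] nonneg t r by auto
        moreover have "e i \<tau>\<^sub>L \<sigma> \<le> e i t \<sigma>" using anti t by simp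
        moreover have "m\<^sup>2 / 2 * (t\<^sup>2 - \<tau>\<^sub>L\<^sup>2) \<le> 0"
          using t power_mono[of t \<tau>\<^sub>L 2] by (intro mult_nonneg_nonpos) auto
        moreover have "(m\<^sup>2 * \<tau>\<^sub>L + p\<^sub>L) * (t - \<tau>\<^sub>L) \<ge> - ((m\<^sup>2 * \<tau>\<^sub>L + p\<^sub>L) * \<tau>\<^sub>L)"
          using t tau_L_pos p\<^sub>L_pos by (simp add: right_diff_distrib)
        ultimately show ?thesis using \<sigma> unfolding H_eq B_def by linarith
      qed
      then show ?thesis using r by blast
    qed
    show "F \<tau>\<^sub>L s\<^sub>L = 0" by (simp add: F_def F_fun_def)
    show "H \<tau>\<^sub>L s\<^sub>L = 0" by (simp add: H_def H_fun_def)
  qed (rule tau_L_pos)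
  from root_extension show ?thesis by (intro exI[of _ radius])
qed

end
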